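(* Let $X$ be a centered Gaussian (column) vector in $\mathbb{R}^r$ with positive definite covariance matrix $P$, and let $\mathcal{X}=XX'$. Let $m\ge 1$, $n\ge 0$, $v=(v_1,\dots,v_m)\in\mathbb{N}^m$ with $|v|=n$, and $p\in\mathbb{N}$. Then: (1) (Recursion) $$M(v,p)=P^{p+1}\Big[\mathrm{Tr}(M(v))\,I+2\sum_{1\le i\le m}M(v_1,\dots,v_{i-1},v_{i+1},\dots,v_m,v_i)\Big].$$ (2) (Matrix-polynomial formulae) $$M(v,p)=\sum_{0\le q\le m+n}\rho^M_{m,n}(v,q)\,P^{1+p+q}\qquad\text{and}\qquad W(m+1,n)=\sum_{0\le q\le m+n}\rho^W_{m,n}(q)\,P^{1+q},$$ where $\rho^M_{m,n}(v,q)$ and $\rho^W_{m,n}(q)$ are the non-negative parameters defined in the context. (3) (Monotonicity) For any $m\ge 1$, $n\ge 0$ and $0\le q\le m+n$, $$\rho^W_{m,n}(q)\ \ge\ 2\Big(1-\frac{1}{n+2}\Big)\rho^W_{m-1,n+1}(q)\qquad\text{and}\qquad W(m+1,n)\ \ge\ 2\Big(1-\frac{1}{n+2}\Big)W(m,n+1),$$ the last inequality being in the Loewner order.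
   Context: $\mathbb{N}=\{0,1,2,\dots\}$; for $v\in\mathbb{N}^m$, $|v|=\sum_i v_i$. $A'$ denotes transpose and $I$ the $r\times r$ identity. For symmetric matrices, $S_1\le S_2$ (Loewner order) means $S_2-S_1$ is positive semidefinite. Matrix product moments: for $v=(v_1,\dots,v_m)\in\mathbb{N}^m$, $$M(v)=\mathbb{E}\big[(\mathcal{X}P^{v_1})(\mathcal{X}P^{v_2})\cdots(\mathcal{X}P^{v_m})\big];$$ for $v\in\mathbb{N}^m$, $p\in\mathbb{N}$, $M(v,p)$ means $M(v_1,\dots,v_m,p)$. Let $V_{m,n}=\{v\in\mathbb{N}^m: |v|=n\}$. For $m\ge1$, $n\ge0$ set $$W(m,n)=\sum_{v\in V_{m,n}}(1+v_m)M(v),\qquad \tau(m,n)=\mathrm{Tr}\Big(\sum_{v\in V_{m,n}}M(v)\Big),$$ with the convention $\tau(0,n)=1$ if $n=0$ and $\tau(0,n)=0$ if $n\geq 1$. $(m)_k=m!/(m-k)!$ for $0\le k\le m$; $\langle m\rangle^{\langle k\rangle}$ is the set of injective maps $a:\{1,\dots,k\}\to\{1,\dots,m\}$. For such $a$ and $v\in\mathbb{N}^m$: $v_a=(v_{a(1)},\dots,v_{a(k)})$ and $v(a)=\sum_{1\le i\le k}v_{a(i)}$. For $v\in\mathbb{N}^k$ with $k\ge1$ put $t_v=\mathrm{Tr}(M(v))$, and $t_\emptyset=1$ for the empty index ($k=0$). For $v\in V_{m,n}$, $0\le k\le m$, $0\le l\le n$: $$t_v(k,l)=\frac{1}{(m)_k}\sum_{a\in\langle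 m\rangle^{\langle k\rangle},\ v(a)=l}t_{v_a}.$$ Let $\Delta_{m,n}(q)=\{(k,l)\in\{0,\dots,m\}\times\{0,\dots,n\}: k+l=q\}$. Then $$\rho^M_{m,n}(v,q)=\sum_{(k,l)\in\Delta_{m,n}(q)}2^k(m)_k\,t_v(m-k,n-l),\qquad \rho^W_{m,n}(q)=\sum_{(k,l)\in\Delta_{m,n}(q)}2^k(m)_k\binom{q+1}{l}\tau(m-k,n-l).$$ *)

theory Defs
  imports "HOL-Probability.Probability"
begin

text \<open>Powers of square matrices have to be defined by hand: the library operation \<open>^\<close> on
  \<open>real^'r^'r\<close> is the componentwise power.\<close>

primrec matpow :: "real^'r^'r \<Rightarrow> nat \<Rightarrow> real^'r^'r" where
  "matpow A 0 = mat 1"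
| "matpow A (Suc k) = A ** matpow A k"

definition symmetric_matrix :: "real^'r^'r \<Rightarrow> bool" where
  "symmetric_matrix A \<longleftrightarrow> transpose A = A"

definition pos_def :: "real^'r^'r \<Rightarrow> bool" where
  "pos_def A \<longleftrightarrow> symmetric_matrix A \<and> (\<forall>x. x \<noteq> 0 \<longrightarrow> 0 < x \<bullet> (A *v x))"

definition pos_semidef :: "real^'r^'r \<Rightarrow> bool" where
  "pos_semidef A \<longleftrightarrow> symmetric_matrix A \<and> (\<forall>x. 0 \<le> x \<bullet> (A *v x))"

definition loewner_le :: "real^'r^'r \<Rightarrow> real^'r^'r \<Rightarrow> bool" where
  "loewner_le A B \<longleftrightarrow> symmetric_matrix A \<and> symmetric_matrix B \<and> pos_semidef (B - A)"

text \<open>A Gaussian vector is a random vector all of whose linear functionals are univariate Gaussian;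
  the second disjunct is the degenerate law of variance zero, which \<open>normal_density\<close> excludes.\<close>

definition gaussian_vector :: "'a measure \<Rightarrow> ('a \<Rightarrow> real^'r) \<Rightarrow> bool" where
  "gaussian_vector M X \<longleftrightarrow> X \<in> borel_measurable M \<and>
     (\<forall>u. (\<exists>\<mu> \<sigma>. 0 < \<sigma> \<and> distributed M lborel (\<lambda>\<omega>. u \<bullet> X \<omega>) (normal_density \<mu> \<sigma>)) \<or>
          (\<exists>\<mu>. AE \<omega> in M. u \<bullet> X \<omega> = \<mu>))"

definition mean_vector :: "'a measure \<Rightarrow> ('a \<Rightarrow> real^'r) \<Rightarrow> real^'r" where
  "mean_vector M X = (\<integral>\<omega>. X \<omega> \<partial>M)"

definition covariance_matrix :: "'a measure \<Rightarrow> ('a \<Rightarrow> real^'r) \<Rightarrow> real^'r^'r" where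
  "covariance_matrix M X =
     (\<chi> i j. \<integral>\<omega>. (X \<omega> $ i - mean_vector M X $ i) * (X \<omega> $ j - mean_vector M X $ j) \<partial>M)"

text \<open>The rank-one matrix \<open>x x'\<close>.\<close>

definition outer_square :: "real^'r \<Rightarrow> real^'r^'r" where
  "outer_square x = (\<chi> i j. x $ i * x $ j)"

text \<open>A multi-index in \<open>\<nat>\<^sup>m\<close> is a list of length \<open>m\<close>; the component \<open>v\<^sub>i\<close> is \<open>v ! (i - 1)\<close>.
  The product below is \<open>(x x' P\<^sup>v\<^sup>1) (x x' P\<^sup>v\<^sup>2) \<dots> (x x' P\<^sup>v\<^sup>m)\<close>, in this order.\<close>

definition sandwich_product :: "real^'r^'r \<Rightarrow> real^'r \<Rightarrow> nat list \<Rightarrow> real^'r^'r" where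
  "sandwich_product P x v = foldr (\<lambda>k B. (outer_square x ** matpow P k) ** B) v (mat 1)"

definition product_moment ::
    "'a measure \<Rightarrow> ('a \<Rightarrow> real^'r) \<Rightarrow> real^'r^'r \<Rightarrow> nat list \<Rightarrow> real^'r^'r" where
  "product_moment M X P v = (\<integral>\<omega>. sandwich_product P (X \<omega>) v \<partial>M)"

definition V_set :: "nat \<Rightarrow> nat \<Rightarrow> nat list set" where
  "V_set m n = {v. length v = m \<and> sum_list v = n}"

text \<open>Meaningful for \<open>m \<ge> 1\<close> only.\<close>

definition W_matrix ::
    "'a measure \<Rightarrow> ('a \<Rightarrow> real^'r) \<Rightarrow> real^'r^'r \<Rightarrow> nat \<Rightarrow> nat \<Rightarrow> real^'r^'r" where
  "W_matrix M X P m n = (\<Sum>v\<in>V_set m n. (1 + real (last v)) *\<^sub>R product_moment M X P v)"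

definition tau ::
    "'a measure \<Rightarrow> ('a \<Rightarrow> real^'r) \<Rightarrow> real^'r^'r \<Rightarrow> nat \<Rightarrow> nat \<Rightarrow> real" where
  "tau M X P m n =
     (if m = 0 then (if n = 0 then 1 else 0)
      else trace (\<Sum>v\<in>V_set m n. product_moment M X P v))"

text \<open>The falling factorial \<open>(m)\<^sub>k\<close>, for \<open>k \<le> m\<close>.\<close>

definition falling :: "nat \<Rightarrow> nat \<Rightarrow> real" where
  "falling m k = fact m / fact (m - k)"

definition injections :: "nat \<Rightarrow> nat \<Rightarrow> (nat \<Rightarrow> nat) set" where
  "injections k m = {a \<in> {..<k} \<rightarrow>\<^sub>E {..<m}. inj_on a {..<k}}"

definition subindex :: "nat list \<Rightarrow> nat \<Rightarrow> (nat \<Rightarrow> nat) \<Rightarrow> nat list" where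
  "subindex v k a = map (\<lambda>i. v ! a i) [0..<k]"

text \<open>For the empty index the value is \<open>1\<close> by convention, not the trace of the identity.\<close>

definition t_index :: "'a measure \<Rightarrow> ('a \<Rightarrow> real^'r) \<Rightarrow> real^'r^'r \<Rightarrow> nat list \<Rightarrow> real" where
  "t_index M X P v = (if v = [] then 1 else trace (product_moment M X P v))"

definition t_avg ::
    "'a measure \<Rightarrow> ('a \<Rightarrow> real^'r) \<Rightarrow> real^'r^'r \<Rightarrow> nat list \<Rightarrow> nat \<Rightarrow> nat \<Rightarrow> real" where
  "t_avg M X P v k l =
     (1 / falling (length v) k) *
     (\<Sum>a | a \<in> injections k (length v) \<and> (\<Sum>i<k. v ! a i) = l. t_index M X P (subindex v k a))"

definition Delta :: "nat \<Rightarrow> nat \<Rightarrow> nat \<Rightarrow> (nat \<times> nat) set" where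
  "Delta m n q = {(k, l). k \<in> {0..m} \<and> l \<in> {0..n} \<and> k + l = q}"

definition rho_M ::
    "'a measure \<Rightarrow> ('a \<Rightarrow> real^'r) \<Rightarrow> real^'r^'r \<Rightarrow> nat \<Rightarrow> nat \<Rightarrow> nat list \<Rightarrow> nat \<Rightarrow> real" where
  "rho_M M X P m n v q =
     (\<Sum>(k, l)\<in>Delta m n q. 2 ^ k * falling m k * t_avg M X P v (m - k) (n - l))"

definition rho_W ::
    "'a measure \<Rightarrow> ('a \<Rightarrow> real^'r) \<Rightarrow> real^'r^'r \<Rightarrow> nat \<Rightarrow> nat \<Rightarrow> nat \<Rightarrow> real" where
  "rho_W M X P m n q =
     (\<Sum>(k, l)\<in>Delta m n q.
        2 ^ k * falling m k * real ((q + 1) choose l) * tau M X P (m - k) (n - l))"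

end

(* Write q_k(x) = x' P^k x. The product (XX'P^v1)...(XX'P^vm)(XX'P^p) equals q_v1(X)...q_vm(X) XX' P^p,
   so every moment in the theorem is an expectation of a product of the forms q_k, possibly times XX'.
   Gaussian integration by parts, E[<w,X> g(X)] = E[Dg(X)(Pw)], applied to X_j times such a product, gives
   the recursion; unrolling it removes the factors one at a time and yields a sum over subsets of indices,
   hence polynomials in P.

   Integration by parts is needed for polynomials only. For powers of one linear form it follows from the
   univariate moments E<u,X>^(n+2) = (n+1) (u'Pu) E<u,X>^n by differentiating along u + s w, and by
   polarization the powers of linear forms span all polynomials.

   Summing the recursion over all v gives tau(m+1,n) >= 2(n+1) tau(m,n+1). With this bound the
   coefficients rho^W(m,n) and rho^W(m-1,n+1) are compared after the shift (k,l) -> (k+1,l-1); the terms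
   with l = 0 have no partner and are absorbed by a neighbouring one. *)

theory Submission
  imports Defs "HOL-Analysis.Weierstrass_Theorems"
begin

section \<open>Polarization\<close>


text \<open>Gaussianity is given only through the laws of the functionals
  \<open>u \<bullet> X\<close>, so there is no joint density to integrate by parts against. The
  multivariate formula must come out of one-dimensional moments, which forces the detour through
  powers of linear forms. The matrices E[q_v1(X)...q_vm(X) XX'] turn out to be polynomials in P.
  They therefore commute with P, and all powers of P can be collected on one side. Once all v of
  given length and weight are summed, the positions become interchangeable: a sum over positions
  turns into a factor m, and the recursion becomes a convolution. The weight 1 + v_m is the starting
  sequence of iterated partial sums, which is where the binomials of rho^W come from. The constant 1
  - 1/(n+2) = (n+1)/(n+2) is adapted to the terms without partner: its n+1 is the factor by which
  the bound on tau absorbs such a term into its neighbour, and the n+2 in the denominator makes room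
  for it.\<close>

text \<open>An iterated finite difference with one step \<open>x a\<close> for every
  \<open>a\<close> in \<open>A\<close>. Each difference lowers the degree, so \<open>card A\<close>
  of them annihilate the lower powers and turn the power \<open>card A\<close> into a constant. The
  lower powers belong to the statement because the induction produces them.\<close>

lemma iterated_difference_power:
  fixes x :: "'i \<Rightarrow> real"
  assumes "finite A" "n \<le> card A"
  shows "(\<Sum>S\<in>Pow A. (-1) ^ card (A - S) * (y + sum x S) ^ n)
           = (if n = card A then fact n * prod x A else 0)"
  using assms
proof (induction A arbitrary: n rule: finite_induct)
  case empty
  then show ?case by simp
next
  case (insert a A)
  let ?e = "\<lambda>n. \<Sum>S\<in>Pow A. (-1) ^ card (A - S) * (y + sum x S) ^ n"
  have disj: "Pow A \<inter> insert a ` Pow A = {}" and inj: "inj_on (insert a) (Pow A)"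
    using insert.hyps by (auto simp: inj_on_def)
  have step: "(-1) ^ card (insert a A - S) * (y + sum x S) ^ n
      + (-1) ^ card (insert a A - insert a S) * (y + sum x (insert a S)) ^ n
      = (-1) ^ card (A - S) * ((y + sum x S + x a) ^ n - (y + sum x S) ^ n)"
    if "S \<in> Pow A" for S
  proof -
    have "finite S" "a \<notin> S"
      using that insert.hyps finite_subset by auto
    moreover have "insert a A - S = insert a (A - S)" "insert a A - insert a S = A - S"
      using that insert.hyps by auto
    ultimately show ?thesis
      using insert.hyps by (simp add: algebra_simps)
  qed
  \<comment> \<open>The difference in direction \<open>a\<close> contains only exponents k < n,
    hence k <= card A, the range of the induction hypothesis. Only k = card A survives, with
    binomial coefficient n when n = card A + 1.\<close>
  have diff: "(z + x a) ^ n - z ^ n = (\<Sum>k<n. real (n choose k) * x a ^ (n - k) * z ^ k)" for z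
    unfolding binomial_ring by (simp add: lessThan_Suc_atMost[symmetric] mult_ac)
  have "(\<Sum>S\<in>Pow (insert a A). (-1) ^ card (insert a A - S) * (y + sum x S) ^ n)
      = (\<Sum>S\<in>Pow A. (-1) ^ card (insert a A - S) * (y + sum x S) ^ n)
        + (\<Sum>S\<in>Pow A. (-1) ^ card (insert a A - insert a S) * (y + sum x (insert a S)) ^ n)"
    unfolding Pow_insert using insert.hyps disj inj
    by (subst sum.union_disjoint) (auto simp: sum.reindex)
  also have "\<dots> = (\<Sum>S\<in>Pow A. (-1) ^ card (A - S) * ((y + sum x S + x a) ^ n - (y + sum x S) ^ n))"
    unfolding sum.distrib[symmetric] using step by (intro sum.cong refl) auto
  also have "\<dots> = (\<Sum>k<n. real (n choose k) * x a ^ (n - k) * ?e k)"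
    unfolding diff sum_distrib_left by (subst sum.swap) (simp add: mult_ac)
  also have "\<dots> = (\<Sum>k<n. real (n choose k) * x a ^ (n - k)
                     * (if k = card A then fact k * prod x A else 0))"
    using insert.prems insert.hyps by (intro sum.cong refl, subst insert.IH) auto
  also have "\<dots> = (if n = card (insert a A) then fact n * prod x (insert a A) else 0)"
  proof (cases "n = Suc (card A)")
    case True
    then show ?thesis
      using insert.hyps by (simp add: if_distrib[of "\<lambda>t. _ * t"] sum.delta' algebra_simps cong: if_cong)
  next
    case False
    then show ?thesis
      using insert.hyps insert.prems by (auto intro!: sum.neutral)
  qed
  finally show ?case .
qed

text \<open>Scalars sit in the generators, so closure under addition yields the whole span. The
  induction rule is the point: an additive property of polynomials needs checking only for powers of
  a single linear form.\<close>

inductive linear_power_span :: "('v::real_inner \<Rightarrow> real) \<Rightarrow> bool" where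
  power: "linear_power_span (\<lambda>x. c * (u \<bullet> x) ^ n)"
| add: "linear_power_span f \<Longrightarrow> linear_power_span g \<Longrightarrow> linear_power_span (\<lambda>x. f x + g x)"

lemma linear_power_span_zero: "linear_power_span (\<lambda>x. 0)"
  using linear_power_span.power[of 0] by simp

lemma linear_power_span_sum:
  assumes "\<And>i. i \<in> A \<Longrightarrow> linear_power_span (f i)"
  shows "linear_power_span (\<lambda>x. \<Sum>i\<in>A. f i x)"
  using assms
  by (induction A rule: infinite_finite_induct)
     (auto intro: linear_power_span_zero linear_power_span.add)

text \<open>Polarization identity: a product of N linear forms is 1/N! times the signed sum of the
  N-th powers of their subset sums. Here N = m + n, and \<open>z\<close> lists \<open>u\<close> m
  times and \<open>w\<close> n times.\<close>

lemma linear_power_span_power_mult: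
  "linear_power_span (\<lambda>x. (c * (u \<bullet> x) ^ m) * (d * (w \<bullet> x) ^ n))"
proof -
  define z where "z i = (if i < m then u else w)" for i :: nat
  have prod: "(\<Prod>i<m + n. z i \<bullet> x) = (u \<bullet> x) ^ m * (w \<bullet> x) ^ n" for x
  proof -
    have "(\<Prod>i<m + n. z i \<bullet> x) = (\<Prod>i<m. z i \<bullet> x) * (\<Prod>i=m..<m+n. z i \<bullet> x)"
      using prod.atLeastLessThan_concat[of 0 m "m + n" "\<lambda>i. z i \<bullet> x"]
      by (simp add: atLeast0LessThan)
    then show ?thesis
      by (simp add: z_def)
  qed
  have "(c * (u \<bullet> x) ^ m) * (d * (w \<bullet> x) ^ n)
      = (\<Sum>S\<in>Pow {..<m + n}. (c * d / fact (m + n) * (-1) ^ card ({..<m + n} - S))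
            * ((\<Sum>i\<in>S. z i) \<bullet> x) ^ (m + n))" for x
  proof -
    have "(\<Sum>S\<in>Pow {..<m + n}. (c * d / fact (m + n) * (-1) ^ card ({..<m + n} - S))
            * ((\<Sum>i\<in>S. z i) \<bullet> x) ^ (m + n))
        = c * d / fact (m + n) * (\<Sum>S\<in>Pow {..<m + n}. (-1) ^ card ({..<m + n} - S)
            * (0 + (\<Sum>i\<in>S. z i \<bullet> x)) ^ (m + n))"
      by (simp only: sum_distrib_left mult.assoc inner_sum_left add_0_left)
    also have "\<dots> = (c * (u \<bullet> x) ^ m) * (d * (w \<bullet> x) ^ n)"
      by (subst iterated_difference_power) (simp_all add: prod)
    finally show ?thesis ..
  qed
  then show ?thesis
    by (simp only:) (intro linear_power_span_sum linear_power_span.power)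
qed

lemma linear_power_span_mult:
  assumes "linear_power_span f" "linear_power_span g"
  shows "linear_power_span (\<lambda>x. f x * g x)"
  using assms(1)
proof induction
  case (power c u m)
  show ?case
    using assms(2)
    by induction (simp_all only: distrib_left linear_power_span_power_mult linear_power_span.add)
next
  case (add f1 f2)
  then show ?case
    by (simp only: distrib_right linear_power_span.add)
qed

lemma linear_power_span_real_polynomial:
  fixes p :: "'v::euclidean_space \<Rightarrow> real"
  assumes "real_polynomial_function p"
  shows "linear_power_span p"
  using assms
proof induction
  case (linear f)
  \<comment> \<open>Riesz representation: \<open>f\<close> is the inner product with
    \<open>adjoint f 1\<close>.\<close>
  have "f = (\<lambda>x. 1 * (adjoint f 1 \<bullet> x) ^ 1)"
    using adjoint_works[OF bounded_linear.linear[OF linear], of _ 1]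
    by (auto simp: inner_commute)
  then show ?case
    using linear_power_span.power by metis
next
  case (const c)
  then show ?case
    using linear_power_span.power[of c _ 0] by simp
qed (auto intro: linear_power_span.add linear_power_span_mult)

section \<open>Integration by parts for Gaussian vectors\<close>


lemma real_polynomial_inner_right: "real_polynomial_function (\<lambda>x. u \<bullet> x)"
  by (intro real_polynomial_function.intros bounded_linear_inner_right)

text \<open>Read off from the closed forms of the even and the odd central moments; the odd ones
  vanish, so that both sides are zero.\<close>

lemma centered_normal_moments:
  assumes "0 < \<sigma>"
  shows "integral\<^sup>L lborel (\<lambda>x. normal_density \<mu> \<sigma> x * (x - \<mu>) ^ (n + 2))
       = real (n + 1) * \<sigma>\<^sup>2 * integral\<^sup>L lborel (\<lambda>x. normal_density \<mu> \<sigma> x * (x - \<mu>) ^ n)"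
proof (cases "even n")
  case True
  then obtain k where k: "n = 2 * k" by (elim evenE)
  have e: "2 * k + 2 = 2 * Suc k" by simp
  show ?thesis
    unfolding k e integral_normal_moment_even[OF assms]
    using assms by (simp add: divide_simps)
next
  case False
  then obtain k where k: "n = 2 * k + 1" by (elim oddE)
  have e: "2 * k + 1 + 2 = 2 * Suc k + 1" by simp
  show ?thesis
    unfolding k e integral_normal_moment_odd[OF assms] by simp
qed

section \<open>Moments of the linear functionals of a centered Gaussian vector\<close>

locale centered_gaussian = prob_space M for M :: "'a measure" +
  fixes X :: "'a \<Rightarrow> real^'r" and P :: "real^'r^'r"
  assumes gaussian: "gaussian_vector M X"
    and mean_zero: "mean_vector M X = 0"
    and covariance: "covariance_matrix M X = P"
    and pos_def: "pos_def P"
begin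

lemma X_measurable [measurable]: "X \<in> borel_measurable M"
  using gaussian by (simp add: gaussian_vector_def)

text \<open>Treats both alternatives of \<open>gaussian_vector\<close> at once: \<open>s\<close> is
  the variance, zero for the degenerate law. The centre \<mu> is kept because
  \<open>mean_vector M X = 0\<close> says something about \<open>u \<bullet> X\<close> only after
  integrability of \<open>X\<close>, which is itself derived from these moments.\<close>

lemma functional_central_moments:
  obtains \<mu> s where
    "\<And>n. integrable M (\<lambda>\<omega>. (u \<bullet> X \<omega> - \<mu>) ^ n)"
    "\<And>n. expectation (\<lambda>\<omega>. (u \<bullet> X \<omega> - \<mu>) ^ (n + 2))
        = real (n + 1) * s * expectation (\<lambda>\<omega>. (u \<bullet> X \<omega> - \<mu>) ^ n)"
    "expectation (\<lambda>\<omega>. u \<bullet> X \<omega> - \<mu>) = 0"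
proof -
  consider \<mu> \<sigma> where "0 < \<sigma>" "distributed M lborel (\<lambda>\<omega>. u \<bullet> X \<omega>) (normal_density \<mu> \<sigma>)"
    | \<mu> where "AE \<omega> in M. u \<bullet> X \<omega> = \<mu>"
    using gaussian unfolding gaussian_vector_def by blast
  then show thesis
  proof cases
    case (1 \<mu> \<sigma>)
    have I: "expectation (\<lambda>\<omega>. (u \<bullet> X \<omega> - \<mu>) ^ n)
        = integral\<^sup>L lborel (\<lambda>x. normal_density \<mu> \<sigma> x * (x - \<mu>) ^ n)" for n
      using distributed_integral[OF 1(2), of "\<lambda>x. (x - \<mu>) ^ n"] by simp
    show thesis
    proof
      show "integrable M (\<lambda>\<omega>. (u \<bullet> X \<omega> - \<mu>) ^ n)" for n
        using distributed_integrable[OF 1(2), of "\<lambda>x. (x - \<mu>) ^ n"]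
          integrable_normal_moment[OF 1(1), of \<mu> n] by simp
      show "expectation (\<lambda>\<omega>. (u \<bullet> X \<omega> - \<mu>) ^ (n + 2))
          = real (n + 1) * \<sigma>\<^sup>2 * expectation (\<lambda>\<omega>. (u \<bullet> X \<omega> - \<mu>) ^ n)" for n
        unfolding I by (rule centered_normal_moments[OF 1(1)])
      show "expectation (\<lambda>\<omega>. u \<bullet> X \<omega> - \<mu>) = 0"
        using I[of 1] integral_normal_moment_odd[OF 1(1), of \<mu> 0] by simp
    qed
  next
    case (2 \<mu>)
    \<comment> \<open>Since 0 ^ 0 = 1, the value 0 ^ n is also right for the moment of order
      zero.\<close>
    have AE: "AE \<omega> in M. (u \<bullet> X \<omega> - \<mu>) ^ n = 0 ^ n" for n
      using 2 by (auto elim: eventually_mono)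
    have I: "expectation (\<lambda>\<omega>. (u \<bullet> X \<omega> - \<mu>) ^ n) = 0 ^ n" for n
      using integral_cong_AE[OF _ _ AE[of n]] by (simp add: prob_space)
    show thesis
    proof
      show "integrable M (\<lambda>\<omega>. (u \<bullet> X \<omega> - \<mu>) ^ n)" for n
        using integrable_cong_AE[OF _ _ AE[of n]] by simp
      show "expectation (\<lambda>\<omega>. (u \<bullet> X \<omega> - \<mu>) ^ (n + 2))
          = real (n + 1) * 0 * expectation (\<lambda>\<omega>. (u \<bullet> X \<omega> - \<mu>) ^ n)" for n
        unfolding I by simp
      show "expectation (\<lambda>\<omega>. u \<bullet> X \<omega> - \<mu>) = 0"
        using I[of 1] by simp
    qed
  qed
qed

lemma integrable_functional: "integrable M (\<lambda>\<omega>. u \<bullet> X \<omega>)"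
proof -
  obtain \<mu> where "\<And>n. integrable M (\<lambda>\<omega>. (u \<bullet> X \<omega> - \<mu>) ^ n)"
    using functional_central_moments[of u] by metis
  from this[of 1] have "integrable M (\<lambda>\<omega>. (u \<bullet> X \<omega> - \<mu>) + \<mu>)"
    by (intro Bochner_Integration.integrable_add) auto
  then show ?thesis by simp
qed

lemma integrable_X: "integrable M X"
proof -
  have "integrable M (\<lambda>\<omega>. \<Sum>b\<in>Basis. (b \<bullet> X \<omega>) *\<^sub>R b)"
    by (intro Bochner_Integration.integrable_sum integrable_scaleR_left integrable_functional)
  then show ?thesis
    by (simp add: inner_commute[of _ "X _"] euclidean_representation)
qed

lemma expectation_functional: "expectation (\<lambda>\<omega>. u \<bullet> X \<omega>) = 0"
  using mean_zero integrable_X by (simp add: mean_vector_def)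

text \<open>The first moment forces \<mu> = 0, and the case n = 0 of the recurrence identifies
  \<open>s\<close> with the second moment.\<close>

lemma functional_moments:
  shows integrable_functional_power: "integrable M (\<lambda>\<omega>. (u \<bullet> X \<omega>) ^ n)"
    and functional_moment_variance: "expectation (\<lambda>\<omega>. (u \<bullet> X \<omega>) ^ (n + 2))
      = real (n + 1) * expectation (\<lambda>\<omega>. (u \<bullet> X \<omega>)\<^sup>2) * expectation (\<lambda>\<omega>. (u \<bullet> X \<omega>) ^ n)"
proof -
  obtain \<mu> s where I: "\<And>n. integrable M (\<lambda>\<omega>. (u \<bullet> X \<omega> - \<mu>) ^ n)"
    and E: "\<And>n. expectation (\<lambda>\<omega>. (u \<bullet> X \<omega> - \<mu>) ^ (n + 2))
        = real (n + 1) * s * expectation (\<lambda>\<omega>. (u \<bullet> X \<omega> - \<mu>) ^ n)"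
    and z: "expectation (\<lambda>\<omega>. u \<bullet> X \<omega> - \<mu>) = 0"
    using functional_central_moments[of u] by metis
  have [simp]: "\<mu> = 0"
    using z by (simp add: integrable_functional expectation_functional prob_space)
  show "integrable M (\<lambda>\<omega>. (u \<bullet> X \<omega>) ^ n)"
    using I by simp
  show "expectation (\<lambda>\<omega>. (u \<bullet> X \<omega>) ^ (n + 2))
      = real (n + 1) * expectation (\<lambda>\<omega>. (u \<bullet> X \<omega>)\<^sup>2) * expectation (\<lambda>\<omega>. (u \<bullet> X \<omega>) ^ n)"
    using E[of n] E[of 0] by (simp add: prob_space numeral_2_eq_2)
qed

lemma integrable_real_polynomial:
  assumes "real_polynomial_function p"
  shows "integrable M (\<lambda>\<omega>. p (X \<omega>))"
  using linear_power_span_real_polynomial[OF assms]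
proof induction
  case (power c u n)
  then show ?case
    using integrable_functional_power[of u n] by simp
qed auto

lemma covariance_component: "P $ i $ j = expectation (\<lambda>\<omega>. X \<omega> $ i * X \<omega> $ j)"
  using covariance[symmetric] by (simp add: covariance_matrix_def mean_zero)

lemma covariance_functionals: "expectation (\<lambda>\<omega>. (u \<bullet> X \<omega>) * (w \<bullet> X \<omega>)) = u \<bullet> (P *v w)"
proof -
  have int: "integrable M (\<lambda>\<omega>. X \<omega> $ i * X \<omega> $ j)" for i j
    by (intro integrable_real_polynomial real_polynomial_function.intros
        bounded_linear_vec_nth)
  have "expectation (\<lambda>\<omega>. (u \<bullet> X \<omega>) * (w \<bullet> X \<omega>))
      = expectation (\<lambda>\<omega>. \<Sum>i\<in>UNIV. \<Sum>j\<in>UNIV. (u $ i * w $ j) * (X \<omega> $ i * X \<omega> $ j))"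
    by (simp add: inner_vec_def sum_product mult_ac)
  also have "\<dots> = (\<Sum>i\<in>UNIV. \<Sum>j\<in>UNIV. (u $ i * w $ j) * P $ i $ j)"
    using int by (simp add: covariance_component)
  also have "\<dots> = u \<bullet> (P *v w)"
    by (simp add: inner_vec_def matrix_vector_mult_def sum_distrib_left mult_ac)
  finally show ?thesis .
qed

section \<open>Integration by parts, from powers of one functional to polynomials\<close>

lemma functional_moment_step:
  "expectation (\<lambda>\<omega>. (u \<bullet> X \<omega>) ^ (n + 2))
     = real (n + 1) * (u \<bullet> (P *v u)) * expectation (\<lambda>\<omega>. (u \<bullet> X \<omega>) ^ n)"
  using functional_moment_variance[of u n] covariance_functionals[of u u]
  by (simp add: power2_eq_square)

lemma integrable_mixed_moment: "integrable M (\<lambda>\<omega>. (u \<bullet> X \<omega>) ^ m * (w \<bullet> X \<omega>) ^ n)"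
  by (rule integrable_real_polynomial[of "\<lambda>x. (u \<bullet> x) ^ m * (w \<bullet> x) ^ n"])
     (intro real_polynomial_function.intros(4) real_polynomial_function_power real_polynomial_inner_right)

text \<open>Along the line the moment is a polynomial in s whose coefficients are mixed moments, so
  a derivative never has to be interchanged with the expectation. At s = 0 only the term k = 1
  remains.\<close>

lemma has_derivative_moment_along_line:
  "((\<lambda>s. expectation (\<lambda>\<omega>. ((u + s *\<^sub>R w) \<bullet> X \<omega>) ^ n)) has_real_derivative
      real n * expectation (\<lambda>\<omega>. (w \<bullet> X \<omega>) * (u \<bullet> X \<omega>) ^ (n - 1))) (at 0)"
proof -
  define a where "a k = expectation (\<lambda>\<omega>. (w \<bullet> X \<omega>) ^ k * (u \<bullet> X \<omega>) ^ (n - k))" for k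
  have "expectation (\<lambda>\<omega>. ((u + s *\<^sub>R w) \<bullet> X \<omega>) ^ n) = (\<Sum>k\<le>n. real (n choose k) * a k * s ^ k)" for s
  proof -
    have "expectation (\<lambda>\<omega>. ((u + s *\<^sub>R w) \<bullet> X \<omega>) ^ n)
        = expectation (\<lambda>\<omega>. \<Sum>k\<le>n. (real (n choose k) * s ^ k) * ((w \<bullet> X \<omega>) ^ k * (u \<bullet> X \<omega>) ^ (n - k)))"
      by (subst add.commute) (simp add: inner_add_left binomial_ring power_mult_distrib mult_ac)
    also have "\<dots> = (\<Sum>k\<le>n. real (n choose k) * a k * s ^ k)"
      using integrable_mixed_moment by (simp add: a_def mult_ac)
    finally show ?thesis .
  qed
  moreover have "((\<lambda>s. \<Sum>k\<le>n. real (n choose k) * a k * s ^ k) has_real_derivative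
      (\<Sum>k\<le>n. real (n choose k) * a k * (real k * 0 ^ (k - 1)))) (at 0)"
    by (auto intro!: derivative_eq_intros sum.cong)
  moreover have "(\<Sum>k\<le>n. real (n choose k) * a k * (real k * 0 ^ (k - 1)))
      = (\<Sum>k\<in>{..n} \<inter> {1}. real (n choose k) * a k * (real k * 0 ^ (k - 1)))"
    by (intro sum.mono_neutral_right) (auto simp: power_0_left)
  moreover have "\<dots> = real n * expectation (\<lambda>\<omega>. (w \<bullet> X \<omega>) * (u \<bullet> X \<omega>) ^ (n - 1))"
    by (cases n) (auto simp: a_def)
  ultimately show ?thesis by simp
qed

text \<open>The recurrence E<z,X>^(m+2) = (m+1) (z'Pz) E<z,X>^m at z = u + s w is differentiated at
  s = 0. The left side yields the wanted expectation with exponent m + 1, the right side the same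
  expectation with exponent m - 1; hence the strong induction.\<close>

lemma stein_power:
  "expectation (\<lambda>\<omega>. (w \<bullet> X \<omega>) * (u \<bullet> X \<omega>) ^ n)
     = real n * (w \<bullet> (P *v u)) * expectation (\<lambda>\<omega>. (u \<bullet> X \<omega>) ^ (n - 1))"
proof (induction n rule: less_induct)
  case (less n)
  consider "n = 0" | m where "n = m + 1" 
    by (metis Suc_eq_plus1 not0_implies_Suc)
  then show ?case
  proof cases
    case 1
    then show ?thesis by (simp add: expectation_functional)
  next
    case (2 m)
    have sym: "u \<bullet> (P *v w) = w \<bullet> (P *v u)"
      using covariance_functionals[of u w] covariance_functionals[of w u] by (simp add: mult.commute)
    let ?Q = "\<lambda>s. (u + s *\<^sub>R w) \<bullet> (P *v (u + s *\<^sub>R w))"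
    let ?F = "\<lambda>n s. expectation (\<lambda>\<omega>. ((u + s *\<^sub>R w) \<bullet> X \<omega>) ^ n)"
    have Q: "?Q s = u \<bullet> (P *v u) + 2 * s * (w \<bullet> (P *v u)) + s\<^sup>2 * (w \<bullet> (P *v w))" for s
      by (simp add: inner_add_left inner_add_right matrix_vector_right_distrib
          matrix_vector_mult_scaleR sym power2_eq_square algebra_simps)
    have dQ: "(?Q has_real_derivative 2 * (w \<bullet> (P *v u))) (at 0)"
      unfolding Q by (auto intro!: derivative_eq_intros)
    have "?F (m + 2) = (\<lambda>s. real (m + 1) * (?Q s * ?F m s))"
      using functional_moment_step[of "u + _ *\<^sub>R w" m] by (auto simp: mult_ac)
    moreover have "((\<lambda>s. real (m + 1) * (?Q s * ?F m s)) has_real_derivative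
       real (m + 1) * (2 * (w \<bullet> (P *v u)) * ?F m 0
        + real m * expectation (\<lambda>\<omega>. (w \<bullet> X \<omega>) * (u \<bullet> X \<omega>) ^ (m - 1)) * ?Q 0)) (at 0)"
      by (intro DERIV_cmult DERIV_mult dQ has_derivative_moment_along_line)
    moreover have "(?F (m + 2) has_real_derivative 
       real (m + 2) * expectation (\<lambda>\<omega>. (w \<bullet> X \<omega>) * (u \<bullet> X \<omega>) ^ (m + 1))) (at 0)"
      using has_derivative_moment_along_line[of u w "m + 2"] by simp
    ultimately have eq: "real (m + 2) * expectation (\<lambda>\<omega>. (w \<bullet> X \<omega>) * (u \<bullet> X \<omega>) ^ (m + 1))
      = real (m + 1) * (2 * (w \<bullet> (P *v u)) * expectation (\<lambda>\<omega>. (u \<bullet> X \<omega>) ^ m)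
        + real m * expectation (\<lambda>\<omega>. (w \<bullet> X \<omega>) * (u \<bullet> X \<omega>) ^ (m - 1)) * (u \<bullet> (P *v u)))"
      using DERIV_unique by fastforce
    have "real m * expectation (\<lambda>\<omega>. (w \<bullet> X \<omega>) * (u \<bullet> X \<omega>) ^ (m - 1)) * (u \<bullet> (P *v u))
       = real m * (w \<bullet> (P *v u)) * expectation (\<lambda>\<omega>. (u \<bullet> X \<omega>) ^ m)"
    proof (cases "m \<ge> 2")
      case True
      then obtain k where k: "m = k + 2" by (metis add.commute le_Suc_ex)
      have "expectation (\<lambda>\<omega>. (w \<bullet> X \<omega>) * (u \<bullet> X \<omega>) ^ (k + 1))
          = real (k + 1) * (w \<bullet> (P *v u)) * expectation (\<lambda>\<omega>. (u \<bullet> X \<omega>) ^ k)"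
        using less.IH[of "k + 1"] 2 k by simp
      then show ?thesis
        using functional_moment_step[of u k] k by (simp add: mult_ac)
    next
      case False
      then have "m = 0 \<or> m = 1" by auto
      then show ?thesis
        by (auto simp: expectation_functional)
    qed
    then have "real (m + 2) * expectation (\<lambda>\<omega>. (w \<bullet> X \<omega>) * (u \<bullet> X \<omega>) ^ (m + 1))
        = real (m + 2) * (real (m + 1) * (w \<bullet> (P *v u)) * expectation (\<lambda>\<omega>. (u \<bullet> X \<omega>) ^ m))"
      by (subst eq) (simp only: distrib_left, simp add: algebra_simps)
    then have "expectation (\<lambda>\<omega>. (w \<bullet> X \<omega>) * (u \<bullet> X \<omega>) ^ (m + 1))
        = real (m + 1) * (w \<bullet> (P *v u)) * expectation (\<lambda>\<omega>. (u \<bullet> X \<omega>) ^ m)"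
      by (subst (asm) mult_cancel_left) auto
    then show ?thesis
      using 2 by simp
  qed
qed

text \<open>The claim is proved for some derivative \<open>h\<close> together with integrability on
  both sides: in this form it is closed under addition, so powers of linear forms suffice.
  Uniqueness of derivatives then identifies \<open>h\<close> with \<open>g'\<close>.\<close>

lemma stein_real_polynomial:
  assumes "real_polynomial_function g"
    and "\<And>x. ((\<lambda>s. g (x + s *\<^sub>R (P *v w))) has_real_derivative g' x) (at 0)"
  shows "expectation (\<lambda>\<omega>. (w \<bullet> X \<omega>) * g (X \<omega>)) = expectation (\<lambda>\<omega>. g' (X \<omega>))"
proof -
  have "\<exists>h. (\<forall>x. ((\<lambda>s. g (x + s *\<^sub>R (P *v w))) has_real_derivative h x) (at 0)) \<and>
      integrable M (\<lambda>\<omega>. (w \<bullet> X \<omega>) * g (X \<omega>)) \<and> integrable M (\<lambda>\<omega>. h (X \<omega>)) \<and>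
      expectation (\<lambda>\<omega>. (w \<bullet> X \<omega>) * g (X \<omega>)) = expectation (\<lambda>\<omega>. h (X \<omega>))"
    using linear_power_span_real_polynomial[OF assms(1)]
  proof induction
    case (power c u n)
    have sym: "u \<bullet> (P *v w) = w \<bullet> (P *v u)"
      using covariance_functionals[of u w] covariance_functionals[of w u] by (simp add: mult.commute)
    let ?h = "\<lambda>x. (c * real n * (u \<bullet> (P *v w))) * (u \<bullet> x) ^ (n - 1)"
    have "((\<lambda>s. c * (u \<bullet> (x + s *\<^sub>R (P *v w))) ^ n) has_real_derivative ?h x) (at 0)" for x
      by (auto intro!: derivative_eq_intros simp: inner_add_right)
    moreover have "integrable M (\<lambda>\<omega>. (w \<bullet> X \<omega>) * (c * (u \<bullet> X \<omega>) ^ n))"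
      using integrable_mixed_moment[of w 1 u n] by (simp add: mult.left_commute)
    moreover have "integrable M (\<lambda>\<omega>. ?h (X \<omega>))"
      by (intro integrable_mult_right integrable_functional_power)
    moreover have "expectation (\<lambda>\<omega>. (w \<bullet> X \<omega>) * (c * (u \<bullet> X \<omega>) ^ n)) = expectation (\<lambda>\<omega>. ?h (X \<omega>))"
      using stein_power[of w u n] by (simp add: mult.left_commute[of _ c] sym)
    ultimately show ?case by (intro exI[of _ ?h]) simp
  next
    case (add f g)
    from add.IH(1) obtain hf where f:
      "\<And>x. ((\<lambda>s. f (x + s *\<^sub>R (P *v w))) has_real_derivative hf x) (at 0)"
      "integrable M (\<lambda>\<omega>. (w \<bullet> X \<omega>) * f (X \<omega>))" "integrable M (\<lambda>\<omega>. hf (X \<omega>))"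
      "expectation (\<lambda>\<omega>. (w \<bullet> X \<omega>) * f (X \<omega>)) = expectation (\<lambda>\<omega>. hf (X \<omega>))"
      by blast
    from add.IH(2) obtain hg where g:
      "\<And>x. ((\<lambda>s. g (x + s *\<^sub>R (P *v w))) has_real_derivative hg x) (at 0)"
      "integrable M (\<lambda>\<omega>. (w \<bullet> X \<omega>) * g (X \<omega>))" "integrable M (\<lambda>\<omega>. hg (X \<omega>))"
      "expectation (\<lambda>\<omega>. (w \<bullet> X \<omega>) * g (X \<omega>)) = expectation (\<lambda>\<omega>. hg (X \<omega>))"
      by blast
    show ?case
      by (rule exI[of _ "\<lambda>x. hf x + hg x"]) (use f g in \<open>auto intro!: DERIV_add simp: distrib_left\<close>)
  qed
  then obtain h where h: "\<And>x. ((\<lambda>s. g (x + s *\<^sub>R (P *v w))) has_real_derivative h x) (at 0)"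
    and E: "expectation (\<lambda>\<omega>. (w \<bullet> X \<omega>) * g (X \<omega>)) = expectation (\<lambda>\<omega>. h (X \<omega>))"
    by blast
  have "h = g'"
    using DERIV_unique[OF h assms(2)] by auto
  then show ?thesis
    using E by simp
qed

end

section \<open>Products of the forms x' P^k x\<close>


lemma matpow_add: "matpow A (m + n) = matpow A m ** matpow A n"
  by (induction m) (simp_all add: matrix_mul_assoc)

lemma matpow_Suc_right: "matpow A (Suc n) = matpow A n ** A"
  using matpow_add[of A n 1] by simp

lemma transpose_matpow:
  assumes "transpose A = A"
  shows "transpose (matpow A n) = matpow A n"
  by (induction n) (simp_all add: matrix_transpose_mul assms flip: matpow_Suc_right)

lemma inner_symmetric_matrix:
  fixes A :: "real^'n^'n"
  assumes "transpose A = A"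
  shows "x \<bullet> (A *v y) = (A *v x) \<bullet> y"
  using assms by (metis dot_lmul_matrix vector_transpose_matrix)

lemma matrix_mult_sum_right:
  fixes A :: "real^'n^'m"
  shows "A ** (\<Sum>i\<in>I. f i) = (\<Sum>i\<in>I. A ** f i)"
  by (simp add: vec_eq_iff matrix_matrix_mult_def sum_distrib_left sum.swap[of _ UNIV I])

lemma matrix_mult_sum_left:
  fixes f :: "'i \<Rightarrow> real^'n^'m"
  shows "(\<Sum>i\<in>I. f i) ** A = (\<Sum>i\<in>I. f i ** A)"
  by (simp add: vec_eq_iff matrix_matrix_mult_def sum_distrib_right sum.swap[of _ UNIV I])

lemma trace_sum: "trace (\<Sum>i\<in>I. f i) = (\<Sum>i\<in>I. trace (f i))"
  by (simp add: trace_def sum.swap[of _ UNIV I])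

lemma trace_scaleR: "trace (c *\<^sub>R A) = c * trace (A :: real^'n^'n)"
  by (simp add: trace_def sum_distrib_left)

text \<open>\<open>product_moment\<close> is a Bochner integral of matrices, while all computations
  are entrywise. Expansion in the basis gives integrability of the matrix, and taking an entry is
  bounded linear.\<close>

lemma integral_matrix_component:
  fixes f :: "'a \<Rightarrow> real^'n^'m"
  assumes "\<And>i j. integrable M (\<lambda>\<omega>. f \<omega> $ i $ j)"
  shows "(\<integral>\<omega>. f \<omega> \<partial>M) $ i $ j = (\<integral>\<omega>. f \<omega> $ i $ j \<partial>M)"
proof -
  have "integrable M (\<lambda>\<omega>. \<Sum>b\<in>Basis. (f \<omega> \<bullet> b) *\<^sub>R b)"
    using assms
    by (intro Bochner_Integration.integrable_sum integrable_scaleR_left)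
       (auto simp: Basis_vec_def inner_axis)
  then have int: "integrable M f"
    by (simp add: euclidean_representation)
  have "bounded_linear (\<lambda>A :: real^'n^'m. A $ i $ j)"
    by (rule bounded_linear_compose[OF bounded_linear_vec_nth bounded_linear_vec_nth])
  from integral_bounded_linear[OF this int] show ?thesis by simp
qed

section \<open>The quadratic forms and the collapse of the matrix product\<close>

definition power_form :: "real^'r^'r \<Rightarrow> nat \<Rightarrow> real^'r \<Rightarrow> real" where
  "power_form P k x = x \<bullet> (matpow P k *v x)"

text \<open>With k = 2h + j and j < 2, P^k = P^h P^j P^h, so the value is that of the form of I or P
  at the vector P^h x. No spectral decomposition enters.\<close>

lemma power_form_nonneg:
  assumes "pos_def P"
  shows "0 \<le> power_form P k x"
proof -
  have sym: "transpose P = P" and pos: "0 \<le> y \<bullet> (P *v y)" for y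
    using assms by (cases "y = 0"; force simp: pos_def_def symmetric_matrix_def)+
  have nonneg: "0 \<le> y \<bullet> (matpow P j *v y)" if "j < 2" for j y
    using that pos by (auto simp: numeral_2_eq_2 less_Suc_eq)
  define h j where "h = k div 2" and "j = k mod 2"
  have "matpow P k = matpow P h ** (matpow P j ** matpow P h)"
    unfolding matpow_add[symmetric] h_def j_def
    by (metis add.commute add.left_commute div_mult_mod_eq mult_2_right)
  then have "power_form P k x = (matpow P h *v x) \<bullet> (matpow P j *v (matpow P h *v x))"
    by (simp add: power_form_def inner_symmetric_matrix[OF transpose_matpow[OF sym]]
        flip: matrix_vector_mul_assoc)
  also have "\<dots> \<ge> 0"
    by (rule nonneg) (simp add: j_def)
  finally show ?thesis .
qed

definition power_form_prod :: "real^'r^'r \<Rightarrow> nat list \<Rightarrow> real^'r \<Rightarrow> real" where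
  "power_form_prod P v x = (\<Prod>k\<leftarrow>v. power_form P k x)"

lemma power_form_prod_simps [simp]:
  "power_form_prod P [] x = 1"
  "power_form_prod P (k # v) x = power_form P k x * power_form_prod P v x"
  "power_form_prod P (u @ v) x = power_form_prod P u x * power_form_prod P v x"
  by (simp_all add: power_form_prod_def)

lemma power_form_prod_nonneg: "pos_def P \<Longrightarrow> 0 \<le> power_form_prod P v x"
  by (induction v) (auto intro: mult_nonneg_nonneg power_form_nonneg)

text \<open>Factors are indexed by positions: the positions are distinct while the exponents
  \<open>w i\<close> may repeat. This is the passage from index lists to the sets of positions over
  which the expansions run.\<close>

lemma power_form_prod_map:
  assumes "distinct is"
  shows "power_form_prod P (map w is) x = (\<Prod>i\<in>set is. power_form P (w i) x)"
  using assms by (simp add: power_form_prod_def prod.distinct_set_conv_list o_def)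

lemma power_form_prod_nth:
  "power_form_prod P v x = (\<Prod>i<length v. power_form P (v ! i) x)"
  using power_form_prod_map[of "[0..<length v]" P "(!) v" x]
  by (simp add: map_nth atLeast0LessThan)

lemma power_form_prod_remove_nth:
  assumes "i < length v"
  shows "power_form_prod P (take i v @ drop (Suc i) v) x
     = (\<Prod>j\<in>{..<length v} - {i}. power_form P (v ! j) x)"
proof -
  have "take i v @ drop (Suc i) v = map ((!) v) ([0..<i] @ [Suc i..<length v])"
    using assms by (auto simp: nth_append list_eq_iff_nth_eq)
  moreover have "set ([0..<i] @ [Suc i..<length v]) = {..<length v} - {i}"
    using assms by auto
  moreover have "distinct ([0..<i] @ [Suc i..<length v])"
    by auto
  ultimately show ?thesis
    by (metis power_form_prod_map)
qed

text \<open>x x' A x x' = x (x'Ax) x', with a scalar in the middle.\<close>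

lemma outer_square_mult_outer_square:
  "outer_square x ** A ** outer_square x = (x \<bullet> (A *v x)) *\<^sub>R outer_square x"
proof -
  have "(\<Sum>b\<in>UNIV. (\<Sum>a\<in>UNIV. x $ i * x $ a * A $ a $ b) * (x $ b * x $ j))
      = (\<Sum>a\<in>UNIV. x $ a * (\<Sum>b\<in>UNIV. A $ a $ b * x $ b)) * (x $ i * x $ j)" for i j
    unfolding sum_distrib_left sum_distrib_right
    by (subst sum.swap) (simp add: mult_ac)
  then show ?thesis
    by (simp add: vec_eq_iff matrix_matrix_mult_def outer_square_def inner_vec_def
        matrix_vector_mult_def)
qed

text \<open>Every inner power is enclosed by two copies of \<open>outer_square x\<close> and
  collapses to a scalar. The last one has nothing to its right and stays, which is why the last
  index is singled out throughout.\<close>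

lemma sandwich_product_snoc:
  "sandwich_product P x (v @ [p]) = power_form_prod P v x *\<^sub>R (outer_square x ** matpow P p)"
proof (induction v)
  case Nil
  then show ?case by (simp add: sandwich_product_def)
next
  case (Cons k v)
  have "sandwich_product P x ((k # v) @ [p])
      = (outer_square x ** matpow P k) ** sandwich_product P x (v @ [p])"
    by (simp add: sandwich_product_def)
  also have "\<dots> = power_form_prod P v x *\<^sub>R
      ((outer_square x ** matpow P k ** outer_square x) ** matpow P p)"
    unfolding Cons by (simp add: matrix_mul_assoc matrix_scalar_ac scalar_matrix_assoc)
  also have "\<dots> = power_form_prod P (k # v) x *\<^sub>R (outer_square x ** matpow P p)"
    unfolding outer_square_mult_outer_square
    by (simp add: power_form_def scalar_matrix_assoc[symmetric] mult.commute)
  finally show ?case .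
qed

lemma real_polynomial_vec_nth: "real_polynomial_function (\<lambda>x :: real^'n. x $ i)"
  by (intro real_polynomial_function.intros bounded_linear_vec_nth)

lemma real_polynomial_power_form: "real_polynomial_function (power_form P k)"
  unfolding power_form_def inner_vec_def inner_real_def
  by (intro real_polynomial_function_sum real_polynomial_function.intros(4) real_polynomial_vec_nth finite
      real_polynomial_function.intros(1) bounded_linear_compose[OF bounded_linear_vec_nth]
      matrix_vector_mul_bounded_linear)

lemma real_polynomial_power_form_prod: "real_polynomial_function (power_form_prod P v)"
  by (induction v) (auto intro: real_polynomial_power_form)

section \<open>Scalar and matrix moments, and their recursion\<close>

context centered_gaussian
begin

lemma transpose_P: "transpose P = P"
  using pos_def by (simp add: pos_def_def symmetric_matrix_def)

definition scalar_moment :: "(real^'r \<Rightarrow> real) \<Rightarrow> real" where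
  "scalar_moment F = expectation (\<lambda>\<omega>. F (X \<omega>))"

text \<open>The matrix E[F(X) XX']. The argument is a function rather than an index list, so that
  products over arbitrary finite sets of positions can be inserted.\<close>

definition matrix_moment :: "(real^'r \<Rightarrow> real) \<Rightarrow> real^'r^'r" where
  "matrix_moment F = (\<chi> a b. expectation (\<lambda>\<omega>. F (X \<omega>) * (X \<omega> $ a * X \<omega> $ b)))"

lemma integrable_weighted_component:
  assumes "real_polynomial_function F"
  shows "integrable M (\<lambda>\<omega>. F (X \<omega>) * (X \<omega> $ a * X \<omega> $ b))"
  by (rule integrable_real_polynomial[of "\<lambda>x. F x * (x $ a * x $ b)"])
     (intro real_polynomial_function.intros(4) real_polynomial_vec_nth assms)

lemma expectation_weighted_outer_square_mult:
  assumes "real_polynomial_function F"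
  shows "expectation (\<lambda>\<omega>. F (X \<omega>) * (outer_square (X \<omega>) ** A) $ a $ b)
      = (matrix_moment F ** A) $ a $ b"
    and "integrable M (\<lambda>\<omega>. F (X \<omega>) * (outer_square (X \<omega>) ** A) $ a $ b)"
proof -
  have eq: "F x * (outer_square x ** A) $ a $ b = (\<Sum>c\<in>UNIV. F x * (x $ a * x $ c) * A $ c $ b)" for x
    by (simp add: outer_square_def matrix_matrix_mult_def sum_distrib_left mult_ac)
  show "expectation (\<lambda>\<omega>. F (X \<omega>) * (outer_square (X \<omega>) ** A) $ a $ b)
      = (matrix_moment F ** A) $ a $ b"
    unfolding eq using integrable_weighted_component[OF assms]
    by (simp add: matrix_matrix_mult_def matrix_moment_def)
  show "integrable M (\<lambda>\<omega>. F (X \<omega>) * (outer_square (X \<omega>) ** A) $ a $ b)"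
    unfolding eq using integrable_weighted_component[OF assms] by simp
qed

lemma product_moment_snoc:
  "product_moment M X P (v @ [p]) = matrix_moment (power_form_prod P v) ** matpow P p"
  unfolding product_moment_def sandwich_product_snoc vec_eq_iff
  using expectation_weighted_outer_square_mult[OF real_polynomial_power_form_prod]
  by (subst integral_matrix_component) auto

lemma trace_matrix_moment_mult:
  assumes "real_polynomial_function F"
  shows "trace (matrix_moment F ** matpow P p) = scalar_moment (\<lambda>x. F x * power_form P p x)"
proof -
  have "x \<bullet> (A *v x) = (\<Sum>a\<in>UNIV. (outer_square x ** A) $ a $ a)" for x :: "real^'r" and A
    by (subst inner_vec_def, simp add: outer_square_def matrix_matrix_mult_def matrix_vector_mult_def
        sum_distrib_left, subst sum.swap, simp add: mult_ac)
  then have "scalar_moment (\<lambda>x. F x * power_form P p x)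
      = expectation (\<lambda>\<omega>. \<Sum>a\<in>UNIV. F (X \<omega>) * (outer_square (X \<omega>) ** matpow P p) $ a $ a)"
    by (simp add: scalar_moment_def power_form_def sum_distrib_left)
  also have "\<dots> = trace (matrix_moment F ** matpow P p)"
    using expectation_weighted_outer_square_mult[OF assms, of "matpow P p"] by (simp add: trace_def)
  finally show ?thesis ..
qed

lemma trace_product_moment_snoc:
  "trace (product_moment M X P (v @ [p])) = scalar_moment (power_form_prod P (v @ [p]))"
  unfolding product_moment_snoc trace_matrix_moment_mult[OF real_polynomial_power_form_prod]
  by (simp add: scalar_moment_def)

text \<open>The value 1 at the empty index is the expectation of the empty product, so the case
  distinction in \<open>t_index\<close> disappears.\<close>

lemma t_index_eq: "t_index M X P v = scalar_moment (power_form_prod P v)"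
  using trace_product_moment_snoc[of "butlast v" "last v"]
  by (cases "v = []") (auto simp: t_index_def scalar_moment_def prob_space)

lemma scalar_moment_power_form_prod_nonneg: "0 \<le> scalar_moment (power_form_prod P v)"
  unfolding scalar_moment_def using pos_def by (simp add: power_form_prod_nonneg)

text \<open>Along a line the form is quadratic in s; symmetry of the power of P merges the two cross
  terms into the factor 2.\<close>

lemma power_form_derivative:
  "((\<lambda>s. power_form P k (x + s *\<^sub>R d)) has_real_derivative 2 * (d \<bullet> (matpow P k *v x))) (at 0)"
proof -
  have "power_form P k (x + s *\<^sub>R d)
      = power_form P k x + s * (2 * (d \<bullet> (matpow P k *v x))) + s\<^sup>2 * power_form P k d" for s
    using inner_symmetric_matrix[OF transpose_matpow[OF transpose_P, of k], of x d]
    by (simp add: power_form_def inner_add_left inner_add_right matrix_vector_right_distrib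
        matrix_vector_mult_scaleR power2_eq_square inner_commute algebra_simps)
  then show ?thesis
    by (simp only:) (auto intro!: derivative_eq_intros)
qed

text \<open>Entry (a, b) is integration by parts with w = e_a, applied to x_b times the product. The
  derivative in direction P e_a hits either x_b, which leaves P_ab, or one factor with exponent w_i,
  which becomes 2 (P^(w_i + 1) x)_a.\<close>

lemma matrix_moment_recursion:
  assumes "finite B"
  shows "matrix_moment (\<lambda>x. \<Prod>i\<in>B. power_form P (w i) x)
    = scalar_moment (\<lambda>x. \<Prod>i\<in>B. power_form P (w i) x) *\<^sub>R P
      + 2 *\<^sub>R (\<Sum>i\<in>B. matpow P (Suc (w i))
                  ** matrix_moment (\<lambda>x. \<Prod>j\<in>B - {i}. power_form P (w j) x))"
proof -
  let ?F = "\<lambda>B x. \<Prod>i\<in>B. power_form P (w i) x"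
  have poly: "real_polynomial_function (?F C)" if "finite C" for C
    using that by (intro real_polynomial_function_prod real_polynomial_power_form)
  have "matrix_moment (?F B) $ a $ b = scalar_moment (?F B) * P $ a $ b
      + 2 * (\<Sum>i\<in>B. (matpow P (Suc (w i)) ** matrix_moment (?F (B - {i}))) $ a $ b)" for a b
  proof -
    let ?d = "P *v axis a 1"
    let ?g' = "\<lambda>x. P $ a $ b * ?F B x
        + (\<Sum>i\<in>B. 2 * (\<Sum>c\<in>UNIV. matpow P (Suc (w i)) $ a $ c * (?F (B - {i}) x * (x $ c * x $ b))))"
    have dir: "?d \<bullet> (matpow P k *v x) = (\<Sum>c\<in>UNIV. matpow P (Suc k) $ a $ c * x $ c)" for k x
    proof -
      have "?d \<bullet> (matpow P k *v x) = axis a 1 \<bullet> (P *v (matpow P k *v x))"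
        by (simp add: inner_symmetric_matrix[OF transpose_P])
      also have "\<dots> = (matpow P (Suc k) *v x) $ a"
        by (simp add: inner_axis' matrix_vector_mul_assoc)
      finally show ?thesis
        by (simp add: matrix_vector_mult_def)
    qed
    have db: "?d $ b = P $ a $ b"
      using transpose_P by (metis column_def matrix_vector_mult_basis transpose_def vec_lambda_beta)
    have "((\<lambda>s. (x + s *\<^sub>R ?d) $ b * ?F B (x + s *\<^sub>R ?d)) has_real_derivative
        ?d $ b * ?F B x
        + (\<Sum>i\<in>B. 2 * (?d \<bullet> (matpow P (w i) *v x)) * ?F (B - {i}) x) * x $ b) (at 0)" for x
    proof -
      have "((\<lambda>s. (x + s *\<^sub>R ?d) $ b) has_real_derivative ?d $ b) (at 0)"
        by (auto intro!: derivative_eq_intros)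
      moreover have "((\<lambda>s. ?F B (x + s *\<^sub>R ?d)) has_real_derivative
          (\<Sum>i\<in>B. 2 * (?d \<bullet> (matpow P (w i) *v x)) * ?F (B - {i}) (x + 0 *\<^sub>R ?d))) (at 0)"
        by (rule has_field_derivative_prod) (rule power_form_derivative)
      ultimately show ?thesis
        using DERIV_mult by fastforce
    qed
    moreover have "?d $ b * ?F B x + (\<Sum>i\<in>B. 2 * (?d \<bullet> (matpow P (w i) *v x)) * ?F (B - {i}) x) * x $ b
       = ?g' x" for x
      unfolding dir db by (simp add: sum_distrib_left sum_distrib_right mult_ac)
    ultimately have deriv:
      "((\<lambda>s. (x + s *\<^sub>R ?d) $ b * ?F B (x + s *\<^sub>R ?d)) has_real_derivative ?g' x) (at 0)" for x
      by simp
    have "matrix_moment (?F B) $ a $ b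
        = expectation (\<lambda>\<omega>. (axis a 1 \<bullet> X \<omega>) * (X \<omega> $ b * ?F B (X \<omega>)))"
      by (simp add: matrix_moment_def inner_axis' mult_ac)
    also have "\<dots> = expectation (\<lambda>\<omega>. ?g' (X \<omega>))"
      by (rule stein_real_polynomial[where g = "\<lambda>x. x $ b * ?F B x", OF _ deriv])
         (intro real_polynomial_function.intros(4) real_polynomial_vec_nth poly assms)
    also have "\<dots> = P $ a $ b * scalar_moment (?F B) + (\<Sum>i\<in>B. 2 * (\<Sum>c\<in>UNIV.
        matpow P (Suc (w i)) $ a $ c * matrix_moment (?F (B - {i})) $ c $ b))"
      using integrable_weighted_component[OF poly] integrable_real_polynomial[OF poly] assms
      by (simp add: matrix_moment_def scalar_moment_def)
    finally show ?thesis
      by (simp add: matrix_matrix_mult_def sum_distrib_left)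
  qed
  then show ?thesis
    by (simp add: vec_eq_iff sum_component)
qed

end

section \<open>Expansion over subsets of indices\<close>


text \<open>Injections with image \<open>C\<close> are the orderings of \<open>C\<close>;
  \<open>restrict\<close> turns a list back into one of the extensional functions that make up
  \<open>injections\<close>.\<close>

lemma card_injections_onto:
  assumes "C \<subseteq> {..<m}" "card C = j"
  shows "card {a \<in> injections j m. a ` {..<j} = C} = fact j"
proof -
  have fin: "finite C"
    using assms(1) finite_subset by blast
  have "bij_betw (\<lambda>a. map a [0..<j]) {a \<in> injections j m. a ` {..<j} = C} (permutations_of_set C)"
  proof (rule bij_betw_byWitness[where f' = "\<lambda>xs. restrict ((!) xs) {..<j}"])
    show "\<forall>a\<in>{a \<in> injections j m. a ` {..<j} = C}. restrict ((!) (map a [0..<j])) {..<j} = a"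
      by (auto simp: injections_def restrict_def fun_eq_iff PiE_def extensional_def)
    show "\<forall>xs\<in>permutations_of_set C. map (restrict ((!) xs) {..<j}) [0..<j] = xs"
      using assms by (auto simp: list_eq_iff_nth_eq length_finite_permutations_of_set)
    show "(\<lambda>a. map a [0..<j]) ` {a \<in> injections j m. a ` {..<j} = C} \<subseteq> permutations_of_set C"
      by (rule image_subsetI)
         (simp add: permutations_of_set_def injections_def distinct_map atLeast0LessThan)
    show "(\<lambda>xs. restrict ((!) xs) {..<j}) ` permutations_of_set C
        \<subseteq> {a \<in> injections j m. a ` {..<j} = C}"
    proof (rule image_subsetI)
      fix xs assume xs: "xs \<in> permutations_of_set C"
      then have *: "length xs = j" "set xs = C" "distinct xs"
        using assms length_finite_permutations_of_set by (auto simp: permutations_of_set_def)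
      then have "restrict ((!) xs) {..<j} ` {..<j} = C"
        by (auto simp: in_set_conv_nth image_iff)
      moreover have "restrict ((!) xs) {..<j} \<in> injections j m"
        using * assms by (auto simp: injections_def inj_on_def nth_eq_iff_index_eq)
      ultimately show "restrict ((!) xs) {..<j} \<in> {a \<in> injections j m. a ` {..<j} = C}"
        by simp
    qed
  qed
  then show ?thesis
    using bij_betw_same_card fin assms by fastforce
qed

text \<open>The summand and the side condition of \<open>t_avg\<close> depend on an injection only
  through its image, so averages over injections become sums over subsets, each counted j!
  times.\<close>

lemma sum_injections_image:
  fixes H :: "nat set \<Rightarrow> real"
  shows "(\<Sum>a\<in>injections j m. H (a ` {..<j})) = fact j * (\<Sum>C | C \<subseteq> {..<m} \<and> card C = j. H C)"
proof -
  have fin: "finite (injections j m)"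
    by (rule finite_subset[of _ "{..<j} \<rightarrow>\<^sub>E {..<m}"]) (auto simp: injections_def finite_PiE)
  have img: "(\<lambda>a. a ` {..<j}) ` injections j m \<subseteq> {C. C \<subseteq> {..<m} \<and> card C = j}"
    by (rule image_subsetI) (simp add: injections_def card_image image_subset_iff PiE_iff)
  have "(\<Sum>a\<in>injections j m. H (a ` {..<j}))
      = (\<Sum>C | C \<subseteq> {..<m} \<and> card C = j. \<Sum>a | a \<in> injections j m \<and> a ` {..<j} = C. H (a ` {..<j}))"
    by (rule sum.group[symmetric]) (use fin img in auto)
  also have "\<dots> = (\<Sum>C | C \<subseteq> {..<m} \<and> card C = j. fact j * H C)"
    by (intro sum.cong refl) (auto simp: card_injections_onto)
  finally show ?thesis
    by (simp add: sum_distrib_left)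
qed

text \<open>Since (m)_(m-k) = m!/k!, the normalization of \<open>t_avg\<close> and the (m-k)!
  orderings of the selected indices reduce to k!, the number of orders in which the other k factors
  can be removed.\<close>

lemma falling_ratio:
  assumes "k \<le> m"
  shows "falling m k * (1 / falling m (m - k) * fact (m - k)) = fact k"
  using assms by (simp add: falling_def)

section \<open>Subset expansion and the coefficients \<open>rho_M\<close>\<close>

context centered_gaussian
begin

text \<open>\<open>A\<close> is the set of factors removed by repeated use of the recursion.
  \<open>fact (card A)\<close> counts the orders of removal, every removal brings a factor 2 and the
  power w_i + 1 of P, and the remaining \<open>Suc\<close> is the single P in the term that ends the
  process.\<close>

lemma matrix_moment_expansion:
  assumes "finite B"
  shows "matrix_moment (\<lambda>x. \<Prod>i\<in>B. power_form P (w i) x)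
    = (\<Sum>A\<in>Pow B. (2 ^ card A * fact (card A) * scalar_moment (\<lambda>x. \<Prod>i\<in>B - A. power_form P (w i) x))
         *\<^sub>R matpow P (Suc (card A + sum w A)))"
  using assms
proof (induction B rule: finite_psubset_induct)
  case (psubset B)
  let ?S = "\<lambda>C. scalar_moment (\<lambda>x. \<Prod>i\<in>C. power_form P (w i) x)"
  let ?N = "\<lambda>C. matrix_moment (\<lambda>x. \<Prod>i\<in>C. power_form P (w i) x)"
  \<comment> \<open>The summand of \<open>A\<close> once its first removed element is fixed, without
    the factor 2 of that removal; there are \<open>card A\<close> choices of the element. The
    truncated \<open>card A - 1\<close> is harmless at the empty set, where the coefficient
    \<open>card A\<close> is zero.\<close>
  define h where "h A = (2 ^ (card A - 1) * fact (card A - 1) * ?S (B - A))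
      *\<^sub>R matpow P (Suc (card A + sum w A))" for A
  have inner: "matpow P (Suc (w i)) ** ?N (B - {i}) = (\<Sum>A | A \<in> Pow B \<and> i \<in> A. h A)" if i: "i \<in> B" for i
  proof -
    have "matpow P (Suc (w i)) ** ?N (B - {i}) = (\<Sum>A\<in>Pow (B - {i}). h (insert i A))"
      using i
    proof (subst psubset.IH, blast, unfold matrix_mult_sum_right, intro sum.cong refl)
      fix A assume A: "A \<in> Pow (B - {i})"
      then have "finite A" "i \<notin> A"
        using psubset.hyps finite_subset by auto
      moreover have "B - {i} - A = B - insert i A"
        by auto
      moreover have e: "Suc (w i) + Suc (card A + sum w A) = Suc (Suc (card A) + (w i + sum w A))"
        by simp
      ultimately show "matpow P (Suc (w i)) ** (2 ^ card A * fact (card A) * ?S (B - {i} - A))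
            *\<^sub>R matpow P (Suc (card A + sum w A)) = h (insert i A)"
        unfolding h_def matrix_scalar_ac scalar_matrix_assoc[symmetric] matpow_add[symmetric] e
        by (simp del: matpow.simps)
    qed
    also have "\<dots> = (\<Sum>A\<in>insert i ` Pow (B - {i}). h A)"
      by (subst sum.reindex) (auto simp: inj_on_def)
    also have "insert i ` Pow (B - {i}) = {A. A \<in> Pow B \<and> i \<in> A}"
    proof -
      have "A \<in> insert i ` Pow (B - {i})" if "A \<subseteq> B" "i \<in> A" for A
        using that by (intro image_eqI[of _ _ "A - {i}"]) auto
      then show ?thesis using i by auto
    qed
    finally show ?thesis .
  qed
  have "(\<Sum>i\<in>B. matpow P (Suc (w i)) ** ?N (B - {i})) = (\<Sum>i\<in>B. \<Sum>A | A \<in> Pow B \<and> i \<in> A. h A)"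
    by (intro sum.cong refl inner)
  also have "\<dots> = (\<Sum>A\<in>Pow B. \<Sum>i | i \<in> B \<and> i \<in> A. h A)"
    using psubset.hyps by (intro sum.swap_restrict) auto
  also have "\<dots> = (\<Sum>A\<in>Pow B. real (card A) *\<^sub>R h A)"
  proof (intro sum.cong refl)
    fix A assume "A \<in> Pow B"
    then have "{i. i \<in> B \<and> i \<in> A} = A" by auto
    then show "(\<Sum>i | i \<in> B \<and> i \<in> A. h A) = real (card A) *\<^sub>R h A"
      by (simp only: sum_constant_scaleR)
  qed
  finally have rec: "?N B = ?S B *\<^sub>R P + (\<Sum>A\<in>Pow B. (2 * real (card A)) *\<^sub>R h A)"
    unfolding matrix_moment_recursion[OF psubset.hyps] by (simp add: scaleR_sum_right)
  have "(2 ^ card A * fact (card A) * ?S (B - A)) *\<^sub>R matpow P (Suc (card A + sum w A))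
      = (if A = {} then ?S B *\<^sub>R P else 0) + (2 * real (card A)) *\<^sub>R h A" if "A \<in> Pow B" for A
  proof (cases "A = {}")
    case False
    with that psubset.hyps have "card A \<noteq> 0"
      using finite_subset by fastforce
    then have "2 ^ card A * fact (card A) = 2 * real (card A) * (2 ^ (card A - 1) * fact (card A - 1))"
      by (cases "card A") auto
    with False show ?thesis
      by (simp add: h_def)
  qed (simp add: h_def)
  then have "(\<Sum>A\<in>Pow B. (2 ^ card A * fact (card A) * ?S (B - A)) *\<^sub>R matpow P (Suc (card A + sum w A)))
      = (\<Sum>A\<in>Pow B. (if A = {} then ?S B *\<^sub>R P else 0) + (2 * real (card A)) *\<^sub>R h A)"
    by (intro sum.cong refl)
  also have "\<dots> = ?N B"
    unfolding sum.distrib rec using psubset.hyps by (simp add: sum.delta)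
  finally show ?case ..
qed

lemma power_form_prod_fun:
  "power_form_prod P v = (\<lambda>x. \<Prod>i<length v. power_form P (v ! i) x)"
  by (simp add: fun_eq_iff power_form_prod_nth)

text \<open>By the expansion the matrix is a polynomial in \<open>P\<close>. This reconciles the
  product moment, where P^p stands on the right, with the recursion, where it stands on the
  left.\<close>

lemma matrix_moment_commute:
  "matrix_moment (power_form_prod P v) ** matpow P p = matpow P p ** matrix_moment (power_form_prod P v)"
  unfolding power_form_prod_fun matrix_moment_expansion[OF finite_lessThan]
    matrix_mult_sum_left matrix_mult_sum_right
  by (intro sum.cong refl)
     (simp only: matrix_scalar_ac scalar_matrix_assoc[symmetric] matpow_add[symmetric] add.commute)

lemma matrix_moment_list_recursion:
  "matrix_moment (power_form_prod P v) = scalar_moment (power_form_prod P v) *\<^sub>R P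
     + 2 *\<^sub>R (\<Sum>i<length v. matpow P (Suc (v ! i))
                 ** matrix_moment (power_form_prod P (take i v @ drop (Suc i) v)))"
proof -
  have "matrix_moment (\<lambda>x. \<Prod>j\<in>{..<length v} - {i}. power_form P (v ! j) x)
      = matrix_moment (power_form_prod P (take i v @ drop (Suc i) v))" if "i < length v" for i
    using that by (intro arg_cong[of _ _ matrix_moment]) (simp add: fun_eq_iff power_form_prod_remove_nth
        del: power_form_prod_simps)
  then show ?thesis
    using matrix_moment_recursion[of "{..<length v}" "(!) v"]
    by (simp only: power_form_prod_fun[symmetric] finite_lessThan simp_thms)
       (simp cong: sum.cong_simp)
qed

text \<open>At the empty index the product moment is the identity with trace r, whereas the scalar
  moment of the empty product is 1; hence \<open>v \<noteq> []\<close>.\<close>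

lemma product_moment_recursion:
  assumes "v \<noteq> []"
  shows "product_moment M X P (v @ [p]) =
      matpow P (p + 1) ** (trace (product_moment M X P v) *\<^sub>R mat 1 +
        2 *\<^sub>R (\<Sum>i<length v. product_moment M X P (take i v @ drop (Suc i) v @ [v ! i])))"
proof -
  let ?N = "\<lambda>v. matrix_moment (power_form_prod P v)"
  have tr: "trace (product_moment M X P v) = scalar_moment (power_form_prod P v)"
    using t_index_eq[of v] assms by (simp add: t_index_def)
  have pm: "product_moment M X P (take i v @ drop (Suc i) v @ [v ! i])
      = matpow P (v ! i) ** ?N (take i v @ drop (Suc i) v)" for i
    using product_moment_snoc[of "take i v @ drop (Suc i) v" "v ! i"] by (simp add: matrix_moment_commute)
  have "product_moment M X P (v @ [p]) = matpow P p ** ?N v"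
    by (simp add: product_moment_snoc matrix_moment_commute)
  also have "\<dots> = matpow P p ** P ** (scalar_moment (power_form_prod P v) *\<^sub>R mat 1 +
      2 *\<^sub>R (\<Sum>i<length v. matpow P (v ! i) ** ?N (take i v @ drop (Suc i) v)))"
    by (subst matrix_moment_list_recursion)
       (simp add: matrix_add_ldistrib matrix_scalar_ac matrix_mult_sum_right matrix_mul_assoc
        flip: scalar_matrix_assoc)
  finally show ?thesis
    by (simp only: tr pm matpow_Suc_right[symmetric] Suc_eq_plus1[symmetric])
qed

lemma t_avg_eq:
  assumes "length v = m"
  shows "t_avg M X P v j l = 1 / falling m j * (fact j *
    (\<Sum>C | C \<subseteq> {..<m} \<and> card C = j \<and> (\<Sum>i\<in>C. v ! i) = l.
        scalar_moment (\<lambda>x. \<Prod>i\<in>C. power_form P (v ! i) x)))"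
proof -
  let ?S = "\<lambda>C. scalar_moment (\<lambda>x. \<Prod>i\<in>C. power_form P (v ! i) x)"
  let ?H = "\<lambda>C. if (\<Sum>i\<in>C. v ! i) = l then ?S C else 0"
  have fin: "finite (injections j m)"
    by (rule finite_subset[of _ "{..<j} \<rightarrow>\<^sub>E {..<m}"]) (auto simp: injections_def finite_PiE)
  have t: "t_index M X P (subindex v j a) = ?S (a ` {..<j})"
    and s: "(\<Sum>i<j. v ! a i) = (\<Sum>i\<in>a ` {..<j}. v ! i)" if "a \<in> injections j m" for a
  proof -
    have inj: "inj_on a {..<j}"
      using that by (simp add: injections_def)
    then show "(\<Sum>i<j. v ! a i) = (\<Sum>i\<in>a ` {..<j}. v ! i)"
      by (simp add: sum.reindex)
    have "subindex v j a = map ((!) v) (map a [0..<j])"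
      by (simp add: subindex_def)
    moreover have "distinct (map a [0..<j])" "set (map a [0..<j]) = a ` {..<j}"
      using inj by (auto simp: distinct_map atLeast0LessThan)
    ultimately have "power_form_prod P (subindex v j a) = (\<lambda>x. \<Prod>i\<in>a ` {..<j}. power_form P (v ! i) x)"
      by (simp only: fun_eq_iff power_form_prod_map simp_thms)
    then show "t_index M X P (subindex v j a) = ?S (a ` {..<j})"
      by (simp add: t_index_eq)
  qed
  have "(\<Sum>a | a \<in> injections j m \<and> (\<Sum>i<j. v ! a i) = l. t_index M X P (subindex v j a))
      = (\<Sum>a\<in>injections j m. ?H (a ` {..<j}))"
    unfolding sum.inter_filter[OF fin] by (intro sum.cong refl) (simp add: t s)
  also have "\<dots> = fact j * (\<Sum>C | C \<subseteq> {..<m} \<and> card C = j. ?H C)"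
    by (rule sum_injections_image)
  also have "(\<Sum>C | C \<subseteq> {..<m} \<and> card C = j. ?H C)
     = (\<Sum>C | C \<subseteq> {..<m} \<and> card C = j \<and> (\<Sum>i\<in>C. v ! i) = l. ?S C)"
    by (subst sum.inter_filter[symmetric]) (auto intro!: sum.cong)
  finally show ?thesis
    using assms by (simp add: t_avg_def)
qed

text \<open>Complementation: the m - k indices selected in \<open>t_avg\<close> are those left after
  removing a set \<open>A\<close> of k positions with weight l. The pairs in \<open>Delta\<close>
  sort the sets \<open>A\<close> for which cardinality plus weight is q, which is the exponent that
  \<open>A\<close> contributes in the expansion.\<close>

lemma rho_M_eq:
  assumes "length v = m" "sum_list v = n"
  shows "rho_M M X P m n v q = (\<Sum>A | A \<in> Pow {..<m} \<and> card A + (\<Sum>i\<in>A. v ! i) = q.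
     2 ^ card A * fact (card A) * scalar_moment (\<lambda>x. \<Prod>i\<in>{..<m} - A. power_form P (v ! i) x))"
proof -
  let ?S = "\<lambda>C. scalar_moment (\<lambda>x. \<Prod>i\<in>C. power_form P (v ! i) x)"
  let ?wt = "\<lambda>A. \<Sum>i\<in>A. v ! i"
  let ?T = "{A. A \<in> Pow {..<m} \<and> card A + ?wt A = q}"
  have n: "?wt {..<m} = n"
    using assms by (simp add: sum_list_sum_nth atLeast0LessThan)
  have wt_compl: "?wt ({..<m} - A) + ?wt A = n" and card_compl: "card ({..<m} - A) + card A = m"
    if "A \<subseteq> {..<m}" for A
    using sum.subset_diff[OF that, of "(!) v"] n card_mono[OF _ that] finite_subset[OF that]
    by (auto simp: card_Diff_subset that)
  have fin: "finite (Delta m n q)"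
    by (rule finite_subset[of _ "{0..m} \<times> {0..n}"]) (auto simp: Delta_def)
  have "rho_M M X P m n v q
      = (\<Sum>(k, l)\<in>Delta m n q. \<Sum>A | A \<in> ?T \<and> (card A, ?wt A) = (k, l). 2 ^ card A * fact (card A) * ?S ({..<m} - A))"
    unfolding rho_M_def
  proof (intro sum.cong refl, safe)
    fix k l assume "(k, l) \<in> Delta m n q"
    then have kl: "k \<le> m" "l \<le> n" "k + l = q"
      by (auto simp: Delta_def)
    have "(\<Sum>C | C \<subseteq> {..<m} \<and> card C = m - k \<and> ?wt C = n - l. ?S C)
        = (\<Sum>A | A \<in> ?T \<and> (card A, ?wt A) = (k, l). ?S ({..<m} - A))"
    proof (rule sum.reindex_bij_witness[where i = "\<lambda>A. {..<m} - A" and j = "\<lambda>A. {..<m} - A"])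
      fix C assume C: "C \<in> {C. C \<subseteq> {..<m} \<and> card C = m - k \<and> ?wt C = n - l}"
      then show "{..<m} - ({..<m} - C) = C" by auto
      show "{..<m} - C \<in> {A \<in> ?T. (card A, ?wt A) = (k, l)}"
        using C wt_compl[of C] card_compl[of C] kl by auto
      show "?S ({..<m} - ({..<m} - C)) = ?S C"
        using C by (simp add: double_diff)
    next
      fix A assume A: "A \<in> {A \<in> ?T. (card A, ?wt A) = (k, l)}"
      then show "{..<m} - ({..<m} - A) = A" by auto
      show "{..<m} - A \<in> {C. C \<subseteq> {..<m} \<and> card C = m - k \<and> ?wt C = n - l}"
        using A wt_compl[of A] card_compl[of A] by auto
    qed
    then have "t_avg M X P v (m - k) (n - l) = 1 / falling m (m - k) * fact (m - k) *
        (\<Sum>A | A \<in> ?T \<and> (card A, ?wt A) = (k, l). ?S ({..<m} - A))"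
      by (simp only: t_avg_eq[OF assms(1)] mult.assoc)
    then have "2 ^ k * falling m k * t_avg M X P v (m - k) (n - l)
      = 2 ^ k * (falling m k * (1 / falling m (m - k) * fact (m - k))) *
        (\<Sum>A | A \<in> ?T \<and> (card A, ?wt A) = (k, l). ?S ({..<m} - A))"
      by (simp only: mult.assoc)
    also have "\<dots> = (\<Sum>A | A \<in> ?T \<and> (card A, ?wt A) = (k, l). 2 ^ card A * fact (card A) * ?S ({..<m} - A))"
      unfolding falling_ratio[OF kl(1)] sum_distrib_left by (intro sum.cong refl) auto
    finally show "2 ^ k * falling m k * t_avg M X P v (m - k) (n - l)
      = (\<Sum>A | A \<in> ?T \<and> (card A, ?wt A) = (k, l). 2 ^ card A * fact (card A) * ?S ({..<m} - A))" .
  qed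
  also have "\<dots> = (\<Sum>A\<in>?T. 2 ^ card A * fact (card A) * ?S ({..<m} - A))"
    unfolding case_prod_unfold prod.collapse
  proof (rule sum.group[OF _ fin])
    show "(\<lambda>A. (card A, ?wt A)) ` ?T \<subseteq> Delta m n q"
    proof (rule image_subsetI)
      fix A assume "A \<in> ?T"
      then show "(card A, ?wt A) \<in> Delta m n q"
        using wt_compl[of A] card_compl[of A] by (auto simp: Delta_def)
    qed
  qed simp
  finally show ?thesis .
qed

lemma scalar_moment_prod_nonneg: "0 \<le> scalar_moment (\<lambda>x. \<Prod>i\<in>B. power_form P (w i) x)"
  unfolding scalar_moment_def using pos_def by (simp add: power_form_nonneg prod_nonneg)

lemma rho_M_nonneg:
  assumes "length v = m" "sum_list v = n"
  shows "0 \<le> rho_M M X P m n v q"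
  unfolding rho_M_eq[OF assms] by (intro sum_nonneg mult_nonneg_nonneg scalar_moment_prod_nonneg) auto

lemma product_moment_polynomial:
  assumes "length v = m" "sum_list v = n"
  shows "product_moment M X P (v @ [p]) = (\<Sum>q\<le>m + n. rho_M M X P m n v q *\<^sub>R matpow P (1 + p + q))"
proof -
  let ?c = "\<lambda>A. 2 ^ card A * fact (card A) * scalar_moment (\<lambda>x. \<Prod>i\<in>{..<m} - A. power_form P (v ! i) x)"
  let ?d = "\<lambda>A. card A + (\<Sum>i\<in>A. v ! i)"
  have d: "?d A \<le> m + n" if "A \<in> Pow {..<m}" for A
  proof -
    have "card A \<le> card {..<m}" "(\<Sum>i\<in>A. v ! i) \<le> (\<Sum>i\<in>{..<m}. v ! i)"
      using that by (intro card_mono sum_mono2; auto)+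
    then show ?thesis
      using assms by (simp add: sum_list_sum_nth atLeast0LessThan)
  qed
  have "product_moment M X P (v @ [p]) = (\<Sum>A\<in>Pow {..<m}. ?c A *\<^sub>R matpow P (1 + p + ?d A))"
    unfolding product_moment_snoc power_form_prod_fun matrix_moment_expansion[OF finite_lessThan]
      matrix_mult_sum_left assms(1)
    by (intro sum.cong refl) (simp only: scalar_matrix_assoc[symmetric] matpow_add[symmetric] add_ac Suc_eq_plus1)
  also have "\<dots> = (\<Sum>q\<le>m + n. \<Sum>A | A \<in> Pow {..<m} \<and> ?d A = q. ?c A *\<^sub>R matpow P (1 + p + ?d A))"
    using d by (intro sum.group[symmetric]) auto
  also have "\<dots> = (\<Sum>q\<le>m + n. rho_M M X P m n v q *\<^sub>R matpow P (1 + p + q))"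
    unfolding rho_M_eq[OF assms] scaleR_sum_left by (intro sum.cong refl) auto
  finally show ?thesis .
qed

end

section \<open>Summation over all multi-indices\<close>


lemma finite_V_set: "finite (V_set m n)"
  by (rule finite_subset[OF _ finite_lists_length_eq[of "{..n}" m]])
     (auto simp: V_set_def dest: member_le_sum_list)

lemma V_set_0: "V_set 0 n = (if n = 0 then {[]} else {})"
  by (auto simp: V_set_def)

lemma sum_list_remove_nth:
  fixes v :: "nat list"
  assumes "l < length v"
  shows "v ! l + sum_list (take l v @ drop (Suc l) v) = sum_list v"
  using arg_cong[OF id_take_nth_drop[OF assms], of sum_list] by simp

text \<open>Extracting entry \<open>l\<close> is a bijection onto pairs of a value \<open>p\<close>
  and a shorter index of weight n - p. The right side does not depend on \<open>l\<close>, which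
  turns sums over positions into multiples.\<close>

lemma sum_V_set_remove:
  fixes f :: "nat \<Rightarrow> nat list \<Rightarrow> 'b::comm_monoid_add"
  assumes "l \<le> m"
  shows "(\<Sum>v\<in>V_set (Suc m) n. f (v ! l) (take l v @ drop (Suc l) v))
       = (\<Sum>p\<le>n. \<Sum>u\<in>V_set m (n - p). f p u)"
proof -
  have "(\<Sum>v\<in>V_set (Suc m) n. f (v ! l) (take l v @ drop (Suc l) v))
      = (\<Sum>(p, u)\<in>Sigma {..n} (\<lambda>p. V_set m (n - p)). f p u)"
  proof (rule sum.reindex_bij_witness[where i = "\<lambda>(p, u). take l u @ p # drop l u"
        and j = "\<lambda>v. (v ! l, take l v @ drop (Suc l) v)"])
    fix v assume v: "v \<in> V_set (Suc m) n"
    then have l: "l < length v"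
      using assms by (simp add: V_set_def)
    show "(case (v ! l, take l v @ drop (Suc l) v) of (p, u) \<Rightarrow> take l u @ p # drop l u) = v"
      using l by (simp add: id_take_nth_drop[symmetric])
    show "(v ! l, take l v @ drop (Suc l) v) \<in> Sigma {..n} (\<lambda>p. V_set m (n - p))"
      using sum_list_remove_nth[OF l] v l by (auto simp: V_set_def)
  next
    fix y assume y: "y \<in> Sigma {..n} (\<lambda>p. V_set m (n - p))"
    then obtain p u where pu: "y = (p, u)" "p \<le> n" "length u = m" "sum_list u = n - p"
      by (auto simp: V_set_def)
    have "sum_list (take l u) + sum_list (drop l u) = sum_list u"
      by (metis append_take_drop_id sum_list_append)
    then show "(case y of (p, u) \<Rightarrow> take l u @ p # drop l u) \<in> V_set (Suc m) n"
      using pu assms by (auto simp: V_set_def)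
    show "((case y of (p, u) \<Rightarrow> take l u @ p # drop l u) ! l,
        take l (case y of (p, u) \<Rightarrow> take l u @ p # drop l u)
          @ drop (Suc l) (case y of (p, u) \<Rightarrow> take l u @ p # drop l u)) = y"
      using pu assms by (simp add: nth_append)
  qed auto
  then show ?thesis
    by (simp add: sum.Sigma finite_V_set)
qed

lemma sum_triangle_swap:
  fixes n :: nat
  shows "(\<Sum>i\<le>n. \<Sum>j\<le>n - i. f i j) = (\<Sum>j\<le>n. \<Sum>i\<le>n - j. f i j)"
proof -
  have "(\<Sum>i\<le>n. \<Sum>j\<le>n - i. f i j) = (\<Sum>i\<le>n. \<Sum>j | j \<in> {..n} \<and> i + j \<le> n. f i j)"
    by (intro sum.cong) auto
  also have "\<dots> = (\<Sum>j\<le>n. \<Sum>i | i \<in> {..n} \<and> i + j \<le> n. f i j)"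
    by (intro sum.swap_restrict) auto
  also have "\<dots> = (\<Sum>j\<le>n. \<Sum>i\<le>n - j. f i j)"
    by (intro sum.cong) auto
  finally show ?thesis .
qed

lemma sum_triangle_diagonal:
  fixes n :: nat
  shows "(\<Sum>i\<le>n. \<Sum>j\<le>n - i. f i j) = (\<Sum>k\<le>n. \<Sum>i\<le>k. f i (k - i))"
proof -
  have "(\<Sum>i\<le>n. \<Sum>j\<le>n - i. f i j) = (\<Sum>(i, j)\<in>Sigma {..n} (\<lambda>i. {..n - i}). f i j)"
    by (subst sum.Sigma) auto
  also have "Sigma {..n} (\<lambda>i. {..n - i}) = {(i, j). i + j \<le> n}"
    by auto
  finally show ?thesis
    by (simp add: sum.triangle_reindex_eq)
qed

lemma falling_Suc_Suc: "falling (Suc m) (Suc k) = real (Suc m) * falling m k"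
  by (simp add: falling_def)

lemma falling_Suc:
  assumes "k < m"
  shows "falling m (Suc k) = real (m - k) * falling m k"
proof -
  have "m - k = Suc (m - Suc k)"
    using assms by simp
  then have "fact (m - k) = real (m - k) * fact (m - Suc k)"
    by (metis fact_Suc of_nat_fact of_nat_mult)
  then show ?thesis
    using assms by (simp add: falling_def)
qed

lemma falling_0 [simp]: "falling m 0 = 1"
  by (simp add: falling_def)

lemma falling_nonneg [simp]: "0 \<le> falling m k"
  by (simp add: falling_def)

section \<open>Recursion and closed form for \<open>W_matrix\<close>\<close>

context centered_gaussian
begin

abbreviation form_moment :: "nat list \<Rightarrow> real" where
  "form_moment v \<equiv> scalar_moment (power_form_prod P v)"

abbreviation form_matrix :: "nat list \<Rightarrow> real^'r^'r" where
  "form_matrix v \<equiv> matrix_moment (power_form_prod P v)"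

lemma tau_eq: "tau M X P m n = (\<Sum>v\<in>V_set m n. form_moment v)"
proof (cases "m = 0")
  case True
  then show ?thesis
    using t_index_eq[of "[]"] by (simp add: tau_def V_set_0 t_index_def)
next
  case False
  have "trace (product_moment M X P v) = form_moment v" if "v \<in> V_set m n" for v
    using t_index_eq[of v] that False by (auto simp: t_index_def V_set_def)
  with False show ?thesis
    by (simp add: tau_def trace_sum)
qed

lemma tau_nonneg: "0 \<le> tau M X P m n"
  unfolding tau_eq by (intro sum_nonneg scalar_moment_power_form_prod_nonneg)

lemma tau_0_Suc: "tau M X P 0 (Suc n) = 0"
  by (simp add: tau_def)

lemma W_matrix_Suc:
  "W_matrix M X P (Suc m) n
     = (\<Sum>p\<le>n. real (Suc p) *\<^sub>R (matpow P p ** (\<Sum>u\<in>V_set m (n - p). form_matrix u)))"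
proof -
  have "(1 + real (last v)) *\<^sub>R product_moment M X P v
      = real (Suc (v ! m)) *\<^sub>R (matpow P (v ! m) ** form_matrix (take m v @ drop (Suc m) v))"
    if "v \<in> V_set (Suc m) n" for v
  proof -
    have len: "length v = Suc m"
      using that by (simp add: V_set_def)
    then have "v = take m v @ [v ! m]" "last v = v ! m"
      by (metis hd_drop_conv_nth lessI take_all take_hd_drop order_refl,
          metis diff_Suc_1 last_conv_nth length_0_conv nat.distinct(1))
    then have "product_moment M X P v = matpow P (v ! m) ** form_matrix (take m v)"
      using product_moment_snoc[of "take m v" "v ! m"] by (simp add: matrix_moment_commute)
    then show ?thesis
      using len \<open>last v = v ! m\<close> by simp
  qed
  then have "W_matrix M X P (Suc m) n = (\<Sum>v\<in>V_set (Suc m) n.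
      real (Suc (v ! m)) *\<^sub>R (matpow P (v ! m) ** form_matrix (take m v @ drop (Suc m) v)))"
    by (simp add: W_matrix_def)
  also have "\<dots> = (\<Sum>p\<le>n. \<Sum>u\<in>V_set m (n - p). real (Suc p) *\<^sub>R (matpow P p ** form_matrix u))"
    by (rule sum_V_set_remove) simp
  finally show ?thesis
    by (simp add: matrix_mult_sum_right scaleR_sum_right)
qed

text \<open>After summation over all v the m removal terms coincide, whence the factor m. At m = 0
  this factor also silences the truncated index \<open>m - 1\<close>.\<close>

lemma form_matrix_sum_recursion:
  "(\<Sum>v\<in>V_set m n. form_matrix v) = tau M X P m n *\<^sub>R P
     + (2 * real m) *\<^sub>R (\<Sum>p\<le>n. matpow P (Suc p) ** (\<Sum>u\<in>V_set (m - 1) (n - p). form_matrix u))"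
proof (cases m)
  case 0
  then show ?thesis
    using matrix_moment_list_recursion[of "[]"] by (simp add: tau_eq V_set_0)
next
  case (Suc k)
  let ?rem = "\<lambda>i v. matpow P (Suc (v ! i)) ** form_matrix (take i v @ drop (Suc i) v)"
  have "(\<Sum>v\<in>V_set m n. form_matrix v)
      = (\<Sum>v\<in>V_set m n. form_moment v *\<^sub>R P + 2 *\<^sub>R (\<Sum>i<m. ?rem i v))"
    by (intro sum.cong refl, subst matrix_moment_list_recursion) (simp add: V_set_def)
  also have "\<dots> = tau M X P m n *\<^sub>R P + 2 *\<^sub>R (\<Sum>i<m. \<Sum>v\<in>V_set m n. ?rem i v)"
    unfolding sum.distrib tau_eq scaleR_sum_left scaleR_sum_right by (subst (2) sum.swap) simp
  also have "(\<Sum>i<m. \<Sum>v\<in>V_set m n. ?rem i v)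
      = (\<Sum>i<m. \<Sum>p\<le>n. \<Sum>u\<in>V_set k (n - p). matpow P (Suc p) ** form_matrix u)"
    unfolding Suc
    by (intro sum.cong refl sum_V_set_remove[where f = "\<lambda>p u. matpow P (Suc p) ** form_matrix u"]) auto
  also have "\<dots> = real m *\<^sub>R (\<Sum>p\<le>n. matpow P (Suc p) ** (\<Sum>u\<in>V_set k (n - p). form_matrix u))"
    by (simp only: sum_constant_scaleR card_lessThan matrix_mult_sum_right)
  finally show ?thesis
    by (simp add: Suc)
qed

text \<open>The preceding recursion is convolved with the weights p + 1. Powers of \<open>P\<close>
  commute and the two convolutions can be exchanged, so the weighted inner sum is again a
  \<open>W_matrix\<close>. For m = 0 the coefficient 2m removes \<open>W_matrix M X P 0\<close>,
  which has no meaning.\<close>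

lemma W_matrix_recursion:
  "W_matrix M X P (Suc m) n
     = (\<Sum>p\<le>n. (real (Suc p) * tau M X P m (n - p)) *\<^sub>R matpow P (Suc p))
       + (2 * real m) *\<^sub>R (\<Sum>p\<le>n. matpow P (Suc p) ** W_matrix M X P m (n - p))"
proof (cases m)
  case 0
  have "(\<Sum>u\<in>V_set 0 j. form_matrix u) = tau M X P 0 j *\<^sub>R P" for j
    by (subst form_matrix_sum_recursion) simp
  then show ?thesis
    unfolding W_matrix_Suc 0
    by (simp only: matrix_scalar_ac scalar_matrix_assoc[symmetric] matpow_Suc_right[symmetric]) simp
next
  case (Suc k)
  let ?G = "\<lambda>m n. \<Sum>u\<in>V_set m n. form_matrix u"
  have "W_matrix M X P (Suc m) n = (\<Sum>p\<le>n. (real (Suc p) * tau M X P m (n - p)) *\<^sub>R matpow P (Suc p)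
      + (2 * real m) *\<^sub>R (\<Sum>j\<le>n - p. matpow P (Suc j) ** (real (Suc p) *\<^sub>R (matpow P p ** ?G k (n - p - j)))))"
    unfolding W_matrix_Suc
  proof (intro sum.cong refl)
    fix p
    have comm: "matpow P p ** (matpow P (Suc j) ** A) = matpow P (Suc j) ** (matpow P p ** A)" for j A
      unfolding matrix_mul_assoc matpow_add[symmetric] by (simp only: add.commute)
    have "real (Suc p) *\<^sub>R (matpow P p ** ?G m (n - p))
       = real (Suc p) *\<^sub>R (tau M X P m (n - p) *\<^sub>R (matpow P p ** P)
          + (2 * real m) *\<^sub>R (\<Sum>j\<le>n - p. matpow P p ** (matpow P (Suc j) ** ?G k (n - p - j))))"
      by (subst form_matrix_sum_recursion)
         (simp only: Suc diff_Suc_1 matrix_add_ldistrib matrix_scalar_ac scalar_matrix_assoc[symmetric]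
          matrix_mult_sum_right scaleR_sum_right)
    also have "\<dots> = (real (Suc p) * tau M X P m (n - p)) *\<^sub>R matpow P (Suc p)
      + (2 * real m) *\<^sub>R (\<Sum>j\<le>n - p. matpow P (Suc j) ** (real (Suc p) *\<^sub>R (matpow P p ** ?G k (n - p - j))))"
      by (simp only: scaleR_add_right scaleR_scaleR matpow_Suc_right[symmetric] comm
          matrix_scalar_ac scalar_matrix_assoc[symmetric] scaleR_sum_right mult_ac)
    finally show "real (Suc p) *\<^sub>R (matpow P p ** ?G m (n - p)) = \<dots>" .
  qed
  also have "\<dots> = (\<Sum>p\<le>n. (real (Suc p) * tau M X P m (n - p)) *\<^sub>R matpow P (Suc p))
      + (2 * real m) *\<^sub>R (\<Sum>j\<le>n. \<Sum>p\<le>n - j. matpow P (Suc j) ** (real (Suc p) *\<^sub>R (matpow P p ** ?G k (n - p - j))))"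
    unfolding sum.distrib scaleR_sum_right[symmetric] by (subst (2) sum_triangle_swap) (rule refl)
  also have "(\<Sum>j\<le>n. \<Sum>p\<le>n - j. matpow P (Suc j) ** (real (Suc p) *\<^sub>R (matpow P p ** ?G k (n - p - j))))
      = (\<Sum>j\<le>n. matpow P (Suc j) ** W_matrix M X P m (n - j))"
    unfolding Suc W_matrix_Suc matrix_mult_sum_right[of _ _ "{.._}"]
    by (simp only: diff_commute)
  finally show ?thesis .
qed

text \<open>Each use of the recursion takes a partial sum, starting from the weights l + 1. In
  generating functions 1/(1 - z)^2 is multiplied k times by 1/(1 - z), and the coefficient of z^l in
  1/(1 - z)^(k + 2) is \<open>(k + l + 1) choose l\<close>.\<close>

lemma W_matrix_closed_form:
  "W_matrix M X P (Suc m) n = (\<Sum>k\<le>m. \<Sum>l\<le>n.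
      (2 ^ k * falling m k * real ((k + l + 1) choose l) * tau M X P (m - k) (n - l))
        *\<^sub>R matpow P (Suc (k + l)))"
proof (induction m arbitrary: n)
  case 0
  then show ?case
    by (subst W_matrix_recursion) (simp add: mult_ac)
next
  case (Suc m)
  define c where "c k l = 2 ^ k * falling m k * real ((k + l + 1) choose l)" for k l
  \<comment> \<open>One more partial sum: the hockey-stick identity raises k by one.\<close>
  have hockey: "(\<Sum>p\<le>L. c k (L - p)) = 2 ^ k * falling m k * real ((Suc k + L + 1) choose L)" for k L
  proof -
    have "(\<Sum>p\<le>L. (k + (L - p) + 1) choose (L - p)) = (\<Sum>p\<le>L. (k + 1 + L - p) choose (L - p))"
      by (intro sum.cong refl arg_cong2[of _ _ _ _ "(choose)"]) auto
    also have "\<dots> = (Suc k + L + 1) choose L"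
      using sum_choose_diagonal[of L "k + 1 + L"] by simp
    finally show ?thesis
      unfolding c_def sum_distrib_left[symmetric] of_nat_sum[symmetric] by simp
  qed
  have "(\<Sum>p\<le>n. matpow P (Suc p) ** W_matrix M X P (Suc m) (n - p))
      = (\<Sum>p\<le>n. \<Sum>k\<le>m. \<Sum>l\<le>n - p. (c k l * tau M X P (m - k) (n - p - l)) *\<^sub>R matpow P (Suc (Suc k + (p + l))))"
    unfolding Suc.IH matrix_mult_sum_right c_def matrix_scalar_ac scalar_matrix_assoc[symmetric]
      matpow_add[symmetric]
    by (intro sum.cong refl) (simp only: add_ac add_Suc add_Suc_right)
  also have "\<dots> = (\<Sum>k\<le>m. \<Sum>p\<le>n. \<Sum>l\<le>n - p. (c k l * tau M X P (m - k) (n - p - l)) *\<^sub>R matpow P (Suc (Suc k + (p + l))))"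
    by (rule sum.swap)
  also have "\<dots> = (\<Sum>k\<le>m. \<Sum>L\<le>n. \<Sum>p\<le>L. (c k (L - p) * tau M X P (m - k) (n - p - (L - p))) *\<^sub>R matpow P (Suc (Suc k + (p + (L - p)))))"
    unfolding sum_triangle_diagonal ..
  also have "\<dots> = (\<Sum>k\<le>m. \<Sum>L\<le>n. ((\<Sum>p\<le>L. c k (L - p)) * tau M X P (m - k) (n - L)) *\<^sub>R matpow P (Suc (Suc k + L)))"
    unfolding sum_distrib_right scaleR_sum_left by (intro sum.cong refl) (simp del: matpow.simps)
  finally have conv: "(\<Sum>p\<le>n. matpow P (Suc p) ** W_matrix M X P (Suc m) (n - p)) = \<dots>" .
  have "(\<Sum>k\<le>Suc m. \<Sum>l\<le>n. (2 ^ k * falling (Suc m) k * real ((k + l + 1) choose l) * tau M X P (Suc m - k) (n - l))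
        *\<^sub>R matpow P (Suc (k + l)))
     = (\<Sum>l\<le>n. (real (Suc l) * tau M X P (Suc m) (n - l)) *\<^sub>R matpow P (Suc l))
      + (\<Sum>k\<le>m. \<Sum>l\<le>n. (2 ^ Suc k * falling (Suc m) (Suc k) * real ((Suc k + l + 1) choose l) * tau M X P (m - k) (n - l))
        *\<^sub>R matpow P (Suc (Suc k + l)))"
    unfolding sum.atMost_Suc_shift by (simp del: matpow.simps)
  also have "\<dots> = W_matrix M X P (Suc (Suc m)) n"
    unfolding W_matrix_recursion[of "Suc m"] conv hockey falling_Suc_Suc scaleR_sum_right
    by (simp only: scaleR_scaleR mult_ac power_Suc)
  finally show ?case ..
qed

lemma W_matrix_polynomial:
  "W_matrix M X P (Suc m) n = (\<Sum>q\<le>m + n. rho_W M X P m n q *\<^sub>R matpow P (1 + q))"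
proof -
  let ?c = "\<lambda>k l. 2 ^ k * falling m k * real ((k + l + 1) choose l) * tau M X P (m - k) (n - l)"
  have "W_matrix M X P (Suc m) n = (\<Sum>(k, l)\<in>{..m} \<times> {..n}. ?c k l *\<^sub>R matpow P (Suc (k + l)))"
    unfolding W_matrix_closed_form by (simp add: sum.cartesian_product del: matpow.simps)
  also have "\<dots> = (\<Sum>q\<le>m + n. \<Sum>kl | kl \<in> {..m} \<times> {..n} \<and> fst kl + snd kl = q.
      case kl of (k, l) \<Rightarrow> ?c k l *\<^sub>R matpow P (Suc (k + l)))"
    by (intro sum.group[symmetric]) auto
  also have "\<dots> = (\<Sum>q\<le>m + n. rho_W M X P m n q *\<^sub>R matpow P (1 + q))"
    unfolding rho_W_def scaleR_sum_left
    by (intro sum.cong refl) (auto simp: Delta_def simp del: matpow.simps)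
  finally show ?thesis .
qed

lemma rho_W_nonneg: "0 \<le> rho_W M X P m n q"
  unfolding rho_W_def by (intro sum_nonneg) (auto intro!: mult_nonneg_nonneg tau_nonneg)

end

section \<open>Monotonicity\<close>


lemma power_form_prod_move_to_end:
  assumes "i < length v"
  shows "power_form_prod P ((take i v @ drop (Suc i) v) @ [v ! i]) = power_form_prod P v"
proof
  fix x
  have "power_form_prod P v x = power_form_prod P (take i v @ v ! i # drop (Suc i) v) x"
    by (simp only: id_take_nth_drop[OF assms, symmetric])
  then show "power_form_prod P ((take i v @ drop (Suc i) v) @ [v ! i]) x = power_form_prod P v x"
    by (simp add: mult_ac)
qed

lemma trace_matpow_nonneg:
  assumes "pos_def P"
  shows "0 \<le> trace (matpow P k)"
proof -
  have "0 \<le> matpow P k $ i $ i" for i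
  proof -
    have "matpow P k $ i $ i = power_form P k (axis i 1)"
      by (simp add: power_form_def inner_axis' matrix_vector_mult_basis column_def)
    then show ?thesis
      by (simp add: power_form_nonneg[OF assms])
  qed
  then show ?thesis
    by (simp add: trace_def sum_nonneg)
qed

section \<open>The coefficient inequality for an abstract array \<open>T\<close> in place of
  \<open>tau\<close>\<close>

text \<open>A left term with second index q - k >= 1 and its partner under the shift have the same
  value of \<open>T\<close>, so only the coefficients have to be compared.\<close>

lemma convolution_termwise_bound:
  fixes T :: "nat \<Rightarrow> nat \<Rightarrow> real"
  assumes nonneg: "\<And>m n. 0 \<le> T m n" and zero: "\<And>n. T 0 (Suc n) = 0"
    and k: "k \<le> m" "k < q" "q - k \<le> Suc n"
  shows "2 * (1 - 1 / (real n + 2)) * (2 ^ k * falling m k * real ((q + 1) choose (q - k)) * T (m - k) (Suc n - (q - k)))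
     \<le> 2 ^ Suc k * falling (Suc m) (Suc k) * real ((q + 1) choose (q - Suc k)) * T (m - k) (n - (q - Suc k))"
proof -
  define l where "l = q - Suc k"
  have l: "q - k = Suc l" "q - Suc k = l" "q = Suc (k + l)" "l \<le> n" "Suc n - (q - k) = n - l"
    using k by (auto simp: l_def)
  \<comment> \<open>Ratio of neighbouring binomials, with q + 1 - l = k + 2; here \<open>l\<close>
    is the second index of the right-hand term.\<close>
  have binom: "real ((q + 1) choose Suc l) = real ((q + 1) choose l) * (real k + 2) / (real l + 1)"
  proof -
    have "Suc l * ((q + 1) choose Suc l) = (q + 1 - l) * ((q + 1) choose l)"
      by (metis binomial_absorb_comp binomial_absorption Suc_eq_plus1 diff_Suc_1)
    then have "Suc l * ((q + 1) choose Suc l) = (k + 2) * ((q + 1) choose l)"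
      using l by simp
    then have "real (Suc l) * real ((q + 1) choose Suc l) = real (k + 2) * real ((q + 1) choose l)"
      by (metis of_nat_mult)
    then show ?thesis
      by (simp add: field_simps)
  qed
  have key: "(1 - 1 / (real n + 2)) * ((real k + 2) / (real l + 1)) * T (m - k) (n - l)
      \<le> (real m + 1) * T (m - k) (n - l)"
  proof (cases "T (m - k) (n - l) = 0")
    case False
    \<comment> \<open>For k < m this follows from k + 2 <= m + 1. For k = m the value T 0 (n - l) is
      non-zero only at l = n, and then the factor l + 1 = n + 1 compensates.\<close>
    have "(real n + 1) * (real k + 2) \<le> (real m + 1) * (real l + 1) * (real n + 2)"
    proof (cases "k = m")
      case True
      with False zero have "n - l = 0"
        by (metis diff_self_eq_0 not0_implies_Suc)
      then have "l = n" using l by simp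
      have "(real n + 1) * (real m + 2) \<le> (real n + 1) * ((real m + 1) * (real n + 2))"
        by (intro mult_left_mono) (auto simp: algebra_simps)
      then show ?thesis
        using True \<open>l = n\<close> by (simp add: mult_ac)
    next
      case False
      then have "real k + 2 \<le> real m + 1" using k by simp
      then have "(real k + 2) * (real n + 1) \<le> ((real m + 1) * (real l + 1)) * (real n + 2)"
        by (intro mult_mono) (auto simp: algebra_simps intro: order_trans)
      then show ?thesis by (simp add: mult_ac)
    qed
    then have "(1 - 1 / (real n + 2)) * ((real k + 2) / (real l + 1)) \<le> real m + 1"
      by (simp add: divide_simps) (simp add: algebra_simps)
    then show ?thesis
      using nonneg by (rule mult_right_mono)
  qed simp
  define d where "d = 1 - 1 / (real n + 2)"
  have "0 \<le> 2 ^ Suc k * falling m k * real ((q + 1) choose l)"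
    by simp
  from mult_left_mono[OF key this] show ?thesis
    unfolding l(1,2) binom falling_Suc_Suc d_def[symmetric] by (simp add: mult_ac add.commute)
qed

text \<open>Here k = q - 1: the terms (q - 1, 1) and (q, 0) on the left share the partner (q, 0) on
  the right, and \<open>real k + 2\<close> is \<open>(q + 1) choose 1\<close>. Writing the constant
  as 2 (n + 1)/(n + 2) puts the factor n + 1 in front of T (m - k - 1) (n + 1), just what
  \<open>step\<close> needs to bound that value by T (m - k) n.\<close>

lemma convolution_corner_bound:
  fixes T :: "nat \<Rightarrow> nat \<Rightarrow> real"
  assumes nonneg: "\<And>m n. 0 \<le> T m n"
    and step: "\<And>m n. 2 * (real n + 1) * T m (Suc n) \<le> T (Suc m) n"
    and k: "Suc k \<le> m"
  shows "2 * (1 - 1 / (real n + 2)) *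
      (2 ^ k * falling m k * (real k + 2) * T (m - k) n + 2 ^ Suc k * falling m (Suc k) * T (m - Suc k) (Suc n))
     \<le> 2 ^ Suc k * falling (Suc m) (Suc k) * T (m - k) n"
proof -
  define t u where "t = T (m - k) n" and "u = T (m - Suc k) (Suc n)"
  have mk: "m - k = Suc (m - Suc k)"
    using k by simp
  have u: "2 * (real n + 1) * u \<le> t"
    unfolding t_def u_def mk by (rule step)
  have t: "0 \<le> t"
    by (simp add: t_def nonneg)
  have k': "real k + 1 \<le> real m"
    using k by simp
  have "(real n + 1) * ((real k + 2) * t + 2 * (real m - real k) * u)
      = (real n + 1) * (real k + 2) * t + (real m - real k) * (2 * (real n + 1) * u)"
    by (simp add: algebra_simps)
  also have "\<dots> \<le> (real n + 1) * (real k + 2) * t + (real m - real k) * t"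
    using u k' by (intro add_left_mono mult_left_mono) auto
  also have "\<dots> = (real n * (real k + 2) + (real m + 2)) * t"
    by (simp add: algebra_simps)
  also have "\<dots> \<le> (real n * (real m + 1) + (2 * real m + 2)) * t"
  proof (rule mult_right_mono[OF _ t])
    have "real n * (real k + 2) \<le> real n * (real m + 1)"
      using k' by (intro mult_left_mono) auto
    then show "real n * (real k + 2) + (real m + 2) \<le> real n * (real m + 1) + (2 * real m + 2)"
      by linarith
  qed
  also have "\<dots> = (real m + 1) * (real n + 2) * t"
    by (simp add: algebra_simps)
  finally have key: "(1 - 1 / (real n + 2)) * ((real k + 2) * t + 2 * (real m - real k) * u) \<le> (real m + 1) * t"
    by (simp add: divide_simps mult_ac add.commute[of 1])
  have "0 \<le> 2 ^ Suc k * falling m k"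
    by simp
  from mult_left_mono[OF key this] show ?thesis
    unfolding falling_Suc_Suc falling_Suc[OF Suc_le_lessD[OF k]] t_def u_def
    using k by (simp add: of_nat_diff algebra_simps)
qed

text \<open>\<open>r\<close> is the summand of \<open>rho_W\<close> with l = q - k eliminated, and
  zero outside the range. Only k = q has l = 0: it does not occur for q > m, and it is merged with k
  = q - 1 for 1 <= q <= m. For q = 0 it is compared by \<open>step\<close> with the term k = 0 on
  the right, to which the shift assigns nothing.\<close>

lemma convolution_mono:
  fixes T :: "nat \<Rightarrow> nat \<Rightarrow> real"
  assumes nonneg: "\<And>m n. 0 \<le> T m n" and zero: "\<And>n. T 0 (Suc n) = 0"
    and step: "\<And>m n. 2 * (real n + 1) * T m (Suc n) \<le> T (Suc m) n"
  defines "r \<equiv> \<lambda>m n q k. if k \<le> q \<and> q - k \<le> n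
      then 2 ^ k * falling m k * real ((q + 1) choose (q - k)) * T (m - k) (n - (q - k)) else 0"
  shows "2 * (1 - 1 / (real n + 2)) * (\<Sum>k\<le>m. r m (Suc n) q k) \<le> (\<Sum>k\<le>Suc m. r (Suc m) n q k)"
proof -
  let ?c = "2 * (1 - 1 / (real n + 2))"
  have r_nonneg: "0 \<le> r m n q k" for m n q k
    by (auto simp: r_def intro!: mult_nonneg_nonneg nonneg)
  have termwise: "?c * r m (Suc n) q k \<le> r (Suc m) n q (Suc k)" if "k \<le> m" "k \<noteq> q" for k
  proof (cases "k < q \<and> q - k \<le> Suc n")
    case True
    then have "Suc k \<le> q" "q - Suc k \<le> n" by auto
    with True show ?thesis
      using convolution_termwise_bound[of T k m q n, OF nonneg zero] that by (simp only: r_def) simp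
  next
    case False
    with that have "r m (Suc n) q k = 0" by (auto simp: r_def)
    then show ?thesis using r_nonneg by simp
  qed
  have shift: "(\<Sum>k\<le>Suc m. r (Suc m) n q k) = r (Suc m) n q 0 + (\<Sum>k\<le>m. r (Suc m) n q (Suc k))"
    by (rule sum.atMost_Suc_shift)
  show ?thesis
  proof (cases "q \<le> m")
    case False
    then have "?c * (\<Sum>k\<le>m. r m (Suc n) q k) \<le> (\<Sum>k\<le>m. r (Suc m) n q (Suc k))"
      unfolding sum_distrib_left by (intro sum_mono termwise) auto
    with shift r_nonneg[of "Suc m" n q 0] show ?thesis by simp
  next
    case True
    show ?thesis
    proof (cases q)
      case 0
      have split: "(\<Sum>k\<le>m. f k) = f 0 + (\<Sum>k\<in>{..m} - {0}. f k)" for f :: "nat \<Rightarrow> real"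
        by (rule sum.remove) auto
      have "1 - 1 / (real n + 2) \<le> real n + 1"
        by (rule order_trans[of _ 1]) simp_all
      then have "?c * T m (Suc n) \<le> 2 * (real n + 1) * T m (Suc n)"
        by (intro mult_right_mono mult_left_mono nonneg) simp_all
      also have "\<dots> \<le> T (Suc m) n"
        by (rule step)
      finally have "?c * r m (Suc n) q 0 \<le> r (Suc m) n q 0"
        using 0 by (simp add: r_def)
      moreover have "?c * (\<Sum>k\<in>{..m} - {0}. r m (Suc n) q k) \<le> (\<Sum>k\<in>{..m} - {0}. r (Suc m) n q (Suc k))"
        unfolding sum_distrib_left using 0 by (intro sum_mono termwise) auto
      ultimately show ?thesis
        unfolding shift split[of "r m (Suc n) q"] split[of "\<lambda>k. r (Suc m) n q (Suc k)"] distrib_left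
        using r_nonneg[of "Suc m" n q "Suc 0"] by linarith
    next
      case (Suc j)
      have split: "(\<Sum>k\<le>m. f k) = f j + (f q + (\<Sum>k\<in>{..m} - {j} - {q}. f k))" for f :: "nat \<Rightarrow> real"
        using True Suc by (simp add: sum.remove[of "{..m}" j] sum.remove[of "{..m} - {j}" q])
      have "?c * (r m (Suc n) q j + r m (Suc n) q q) \<le> r (Suc m) n q (Suc j)"
        using convolution_corner_bound[of T j m n, OF nonneg step] True Suc
        by (simp add: r_def add_ac)
      moreover have "?c * (\<Sum>k\<in>{..m} - {j} - {q}. r m (Suc n) q k)
          \<le> (\<Sum>k\<in>{..m} - {j} - {q}. r (Suc m) n q (Suc k))"
        unfolding sum_distrib_left by (intro sum_mono termwise) auto
      ultimately show ?thesis
        unfolding shift split[of "r m (Suc n) q"] split[of "\<lambda>k. r (Suc m) n q (Suc k)"] distrib_left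
        using r_nonneg[of "Suc m" n q "Suc q"] r_nonneg[of "Suc m" n q 0] by linarith
    qed
  qed
qed

lemma rho_W_alt:
  "rho_W M X P m n q = (\<Sum>k\<le>m. if k \<le> q \<and> q - k \<le> n
     then 2 ^ k * falling m k * real ((q + 1) choose (q - k)) * tau M X P (m - k) (n - (q - k)) else 0)"
proof -
  have "rho_W M X P m n q = (\<Sum>k | k \<in> {..m} \<and> (k \<le> q \<and> q - k \<le> n).
      2 ^ k * falling m k * real ((q + 1) choose (q - k)) * tau M X P (m - k) (n - (q - k)))"
    unfolding rho_W_def
    by (rule sum.reindex_bij_witness[where i = "\<lambda>k. (k, q - k)" and j = fst]) (auto simp: Delta_def)
  then show ?thesis
    by (simp only: sum.inter_filter[OF finite_atMost])
qed

section \<open>Lower bound for \<open>tau\<close> and the Loewner inequality\<close>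

context centered_gaussian
begin

text \<open>The trace of the recursion multiplied by P^p. The form with exponent p either closes up
  to a trace or merges with a form of exponent u_i into one of exponent p + u_i + 1.\<close>

lemma form_moment_snoc:
  "form_moment (u @ [p]) = form_moment u * trace (matpow P (Suc p))
     + 2 * (\<Sum>i<length u. form_moment ((take i u @ drop (Suc i) u) @ [Suc (p + u ! i)]))"
proof -
  have tr: "form_moment (v @ [k]) = trace (matpow P k ** form_matrix v)" for v k
    using trace_product_moment_snoc[of v k] by (simp add: product_moment_snoc matrix_moment_commute)
  have "matpow P p ** form_matrix u = form_moment u *\<^sub>R matpow P (Suc p)
      + 2 *\<^sub>R (\<Sum>i<length u. matpow P (Suc (p + u ! i)) ** form_matrix (take i u @ drop (Suc i) u))"
    by (subst matrix_moment_list_recursion)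
       (simp only: matrix_add_ldistrib matrix_scalar_ac scalar_matrix_assoc[symmetric]
          matrix_mult_sum_right matrix_mul_assoc matpow_add[symmetric] matpow_Suc_right[symmetric]
          add_Suc_right scaleR_sum_right)
  then show ?thesis
    unfolding tr by (simp only: trace_add trace_scaleR trace_sum)
qed

lemma sum_V_set_snoc:
  assumes "i \<le> m"
  shows "(\<Sum>v\<in>V_set (Suc m) n. f (v ! i) * form_moment v)
       = (\<Sum>p\<le>n. \<Sum>u\<in>V_set m (n - p). f p * form_moment (u @ [p]))"
proof -
  have "(\<Sum>v\<in>V_set (Suc m) n. f (v ! i) * form_moment v)
      = (\<Sum>v\<in>V_set (Suc m) n. f (v ! i) * form_moment ((take i v @ drop (Suc i) v) @ [v ! i]))"
    using assms by (intro sum.cong refl, subst power_form_prod_move_to_end) (auto simp: V_set_def)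
  also have "\<dots> = (\<Sum>p\<le>n. \<Sum>u\<in>V_set m (n - p). f p * form_moment (u @ [p]))"
    by (rule sum_V_set_remove[OF assms])
  finally show ?thesis .
qed

text \<open>The factor n + 1 is written as the sum of the entries of v. Every position contributes
  equally, and entries 0 contribute nothing, which shifts p by one.\<close>

lemma tau_weighted:
  "real (Suc n) * tau M X P (Suc m) (Suc n)
     = real (Suc m) * (\<Sum>p\<le>n. real (Suc p) * (\<Sum>u\<in>V_set m (n - p). form_moment (u @ [Suc p])))"
proof -
  have "real (Suc n) * tau M X P (Suc m) (Suc n)
      = (\<Sum>v\<in>V_set (Suc m) (Suc n). \<Sum>i<Suc m. real (v ! i) * form_moment v)"
    unfolding tau_eq sum_distrib_left
  proof (intro sum.cong refl)
    fix v assume "v \<in> V_set (Suc m) (Suc n)"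
    then have "(\<Sum>i<Suc m. v ! i) = Suc n"
      by (auto simp: V_set_def sum_list_sum_nth atLeast0LessThan)
    then have "(\<Sum>i<Suc m. real (v ! i)) = real (Suc n)"
      by (metis of_nat_sum)
    then show "real (Suc n) * form_moment v = (\<Sum>i<Suc m. real (v ! i) * form_moment v)"
      by (simp only: sum_distrib_right[symmetric])
  qed
  also have "\<dots> = (\<Sum>i<Suc m. \<Sum>v\<in>V_set (Suc m) (Suc n). real (v ! i) * form_moment v)"
    by (rule sum.swap)
  also have "\<dots> = (\<Sum>i<Suc m. \<Sum>p\<le>Suc n. \<Sum>u\<in>V_set m (Suc n - p). real p * form_moment (u @ [p]))"
    by (intro sum.cong refl sum_V_set_snoc) simp
  also have "\<dots> = real (Suc m) * (\<Sum>p\<le>Suc n. \<Sum>u\<in>V_set m (Suc n - p). real p * form_moment (u @ [p]))"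
    by simp
  also have "(\<Sum>p\<le>Suc n. \<Sum>u\<in>V_set m (Suc n - p). real p * form_moment (u @ [p]))
      = (\<Sum>p\<le>n. real (Suc p) * (\<Sum>u\<in>V_set m (n - p). form_moment (u @ [Suc p])))"
    unfolding sum.atMost_Suc_shift sum_distrib_left by simp
  finally show ?thesis .
qed

text \<open>Only the merging terms of \<open>form_moment_snoc\<close> are kept; the trace term is
  non-negative. A merged exponent L + 1 arises from the L + 1 splittings p + j = L, so each index is
  weighted by its last entry, and \<open>tau_weighted\<close> evaluates this weighting. That yields
  n + 1; the 2 is the one of the recursion.\<close>

lemma tau_step: "2 * (real n + 1) * tau M X P m (Suc n) \<le> tau M X P (Suc m) n"
proof (cases m)
  case 0
  then show ?thesis
    by (simp add: tau_0_Suc tau_nonneg)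
next
  case (Suc k)
  let ?F = "\<lambda>L. \<Sum>y\<in>V_set k (n - L). form_moment (y @ [Suc L])"
  let ?g = "\<lambda>p i u. form_moment ((take i u @ drop (Suc i) u) @ [Suc (p + u ! i)])"
  have "2 * (\<Sum>p\<le>n. \<Sum>u\<in>V_set m (n - p). \<Sum>i<m. ?g p i u)
      = (\<Sum>p\<le>n. \<Sum>u\<in>V_set m (n - p). 2 * (\<Sum>i<m. ?g p i u))"
    by (simp only: sum_distrib_left)
  also have "\<dots> \<le> (\<Sum>p\<le>n. \<Sum>u\<in>V_set m (n - p). form_moment (u @ [p]))"
  proof (intro sum_mono)
    fix p u assume "u \<in> V_set m (n - p)"
    then have "length u = m" by (simp add: V_set_def)
    moreover have "0 \<le> form_moment u * trace (matpow P (Suc p))"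
      by (intro mult_nonneg_nonneg scalar_moment_power_form_prod_nonneg trace_matpow_nonneg pos_def)
    ultimately show "2 * (\<Sum>i<m. ?g p i u) \<le> form_moment (u @ [p])"
      unfolding form_moment_snoc[of u p] by simp
  qed
  also have "\<dots> = tau M X P (Suc m) n"
    using sum_V_set_snoc[of m m "\<lambda>_. 1" n] by (simp add: tau_eq)
  finally have bound: "2 * (\<Sum>p\<le>n. \<Sum>u\<in>V_set m (n - p). \<Sum>i<m. ?g p i u) \<le> tau M X P (Suc m) n" .
  have "(\<Sum>u\<in>V_set m (n - p). \<Sum>i<m. ?g p i u)
      = real m * (\<Sum>j\<le>n - p. \<Sum>y\<in>V_set k (n - p - j). form_moment (y @ [Suc (p + j)]))" for p
  proof -
    have "(\<Sum>u\<in>V_set m (n - p). \<Sum>i<m. ?g p i u) = (\<Sum>i<m. \<Sum>u\<in>V_set m (n - p). ?g p i u)"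
      by (rule sum.swap)
    also have "\<dots> = (\<Sum>i<m. \<Sum>j\<le>n - p. \<Sum>y\<in>V_set k (n - p - j). form_moment (y @ [Suc (p + j)]))"
      unfolding Suc
      by (intro sum.cong refl sum_V_set_remove[where f = "\<lambda>j y. form_moment (y @ [Suc (p + j)])"]) auto
    finally show ?thesis by simp
  qed
  then have "(\<Sum>p\<le>n. \<Sum>u\<in>V_set m (n - p). \<Sum>i<m. ?g p i u)
      = real m * (\<Sum>p\<le>n. \<Sum>j\<le>n - p. \<Sum>y\<in>V_set k (n - p - j). form_moment (y @ [Suc (p + j)]))"
    by (simp only: sum_distrib_left)
  also have "\<dots> = real m * (\<Sum>L\<le>n. \<Sum>p\<le>L. ?F L)"
    unfolding sum_triangle_diagonal[of _ n]
    by (intro arg_cong[of _ _ "\<lambda>t. real m * t"] sum.cong refl) auto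
  also have "\<dots> = real m * (\<Sum>L\<le>n. real (Suc L) * ?F L)"
    by simp
  also have "\<dots> = (real n + 1) * tau M X P m (Suc n)"
    using tau_weighted[of n k] unfolding Suc by (simp add: add.commute)
  finally show ?thesis
    using bound by (simp only: mult.assoc)
qed

lemma rho_W_mono:
  "2 * (1 - 1 / (real n + 2)) * rho_W M X P m (Suc n) q \<le> rho_W M X P (Suc m) n q"
  unfolding rho_W_alt
  by (rule convolution_mono) (rule tau_nonneg tau_0_Suc tau_step)+

lemma symmetric_W_matrix: "symmetric_matrix (W_matrix M X P (Suc m) n)"
proof -
  have "matpow P k $ i $ j = matpow P k $ j $ i" for k i j
    using transpose_matpow[OF transpose_P, of k] by (metis transpose_def vec_lambda_beta)
  then show ?thesis
    unfolding W_matrix_polynomial symmetric_matrix_def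
    by (simp add: transpose_def vec_eq_iff sum_component del: matpow.simps)
qed

text \<open>As m + (n + 1) = (m + 1) + n, both sides are polynomials in \<open>P\<close> over the
  same range of exponents. Their difference has non-negative coefficients, and every power of
  \<open>P\<close> has a non-negative form.\<close>

lemma W_matrix_mono:
  "loewner_le ((2 * (1 - 1 / (real n + 2))) *\<^sub>R W_matrix M X P (Suc m) (Suc n))
     (W_matrix M X P (Suc (Suc m)) n)"
proof -
  let ?c = "2 * (1 - 1 / (real n + 2))"
  let ?D = "W_matrix M X P (Suc (Suc m)) n - ?c *\<^sub>R W_matrix M X P (Suc m) (Suc n)"
  have sym: "symmetric_matrix (?c *\<^sub>R W_matrix M X P (Suc m) (Suc n))"
    using symmetric_W_matrix[of m "Suc n"]
    by (simp add: symmetric_matrix_def transpose_def vec_eq_iff)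
  have symD: "symmetric_matrix ?D"
    using sym symmetric_W_matrix[of "Suc m" n]
    by (simp add: symmetric_matrix_def transpose_def vec_eq_iff)
  have D: "?D = (\<Sum>q\<le>Suc m + n. (rho_W M X P (Suc m) n q - ?c * rho_W M X P m (Suc n) q) *\<^sub>R matpow P (1 + q))"
    unfolding W_matrix_polynomial scaleR_sum_right
    by (simp only: add_Suc add_Suc_right scaleR_scaleR sum_subtractf[symmetric] scaleR_left_diff_distrib)
  have "x \<bullet> (?D *v x) = (\<Sum>q\<le>Suc m + n. (rho_W M X P (Suc m) n q - ?c * rho_W M X P m (Suc n) q) * power_form P (1 + q) x)" for x
  proof -
    have lin: "(\<Sum>q\<in>Q. f q *\<^sub>R A q) *v x = (\<Sum>q\<in>Q. f q *\<^sub>R (A q *v x))"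
      for Q :: "nat set" and f and A :: "nat \<Rightarrow> real^'r^'r"
      by (induction Q rule: infinite_finite_induct)
         (auto simp: matrix_vector_mult_add_rdistrib scaleR_matrix_vector_assoc[symmetric])
    show ?thesis
      unfolding D lin power_form_def by (simp only: inner_sum_right inner_scaleR_right)
  qed
  also have "\<dots> x \<ge> 0" for x
    using rho_W_mono by (intro sum_nonneg mult_nonneg_nonneg power_form_nonneg pos_def) simp
  finally show ?thesis
    using sym symD symmetric_W_matrix[of "Suc m" n] by (simp add: loewner_le_def pos_semidef_def)
qed

end

theorem theorem1p1:
  fixes M :: "'a measure"
    and X :: "'a \<Rightarrow> real^'r"
    and P :: "real^'r^'r"
  assumes "prob_space M"
    and "gaussian_vector M X"
    and "mean_vector M X = 0"
    and "covariance_matrix M X = P"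
    and "pos_def P"
  shows
    "(\<forall>m\<ge>1. \<forall>n. \<forall>v p. length v = m \<longrightarrow> sum_list v = n \<longrightarrow>
        product_moment M X P (v @ [p]) =
          matpow P (p + 1) **
            (trace (product_moment M X P v) *\<^sub>R mat 1 +
             2 *\<^sub>R (\<Sum>i<m. product_moment M X P (take i v @ drop (Suc i) v @ [v ! i]))))
     \<and>
     (\<forall>m\<ge>1. \<forall>n.
        (\<forall>v p. length v = m \<longrightarrow> sum_list v = n \<longrightarrow>
           (\<forall>q\<le>m + n. 0 \<le> rho_M M X P m n v q) \<and>
           product_moment M X P (v @ [p]) =
             (\<Sum>q\<le>m + n. rho_M M X P m n v q *\<^sub>R matpow P (1 + p + q))) \<and>
        (\<forall>q\<le>m + n. 0 \<le> rho_W M X P m n q) \<and>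
        W_matrix M X P (m + 1) n = (\<Sum>q\<le>m + n. rho_W M X P m n q *\<^sub>R matpow P (1 + q)))
     \<and>
     (\<forall>m\<ge>1. \<forall>n.
        (\<forall>q\<le>m + n.
           rho_W M X P m n q \<ge> 2 * (1 - 1 / (real n + 2)) * rho_W M X P (m - 1) (n + 1) q) \<and>
        loewner_le ((2 * (1 - 1 / (real n + 2))) *\<^sub>R W_matrix M X P m (n + 1))
                   (W_matrix M X P (m + 1) n))"
proof -
  interpret centered_gaussian M X P
    using assms by (simp add: centered_gaussian_def centered_gaussian_axioms_def)
  show ?thesis
  proof (intro conjI allI impI)
    fix m n p :: nat and v :: "nat list"
    assume "1 \<le> m" "length v = m" "sum_list v = n"
    then show "product_moment M X P (v @ [p]) =
        matpow P (p + 1) ** (trace (product_moment M X P v) *\<^sub>R mat 1 +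
          2 *\<^sub>R (\<Sum>i<m. product_moment M X P (take i v @ drop (Suc i) v @ [v ! i])))"
      using product_moment_recursion[of v p] by fastforce
  next
    fix m n p q :: nat and v :: "nat list"
    assume "length v = m" "sum_list v = n"
    then show "0 \<le> rho_M M X P m n v q"
      by (rule rho_M_nonneg)
  next
    fix m n p :: nat and v :: "nat list"
    assume "length v = m" "sum_list v = n"
    then show "product_moment M X P (v @ [p]) = (\<Sum>q\<le>m + n. rho_M M X P m n v q *\<^sub>R matpow P (1 + p + q))"
      by (rule product_moment_polynomial)
  next
    fix m n q :: nat
    show "0 \<le> rho_W M X P m n q"
      by (rule rho_W_nonneg)
  next
    fix m n :: nat
    show "W_matrix M X P (m + 1) n = (\<Sum>q\<le>m + n. rho_W M X P m n q *\<^sub>R matpow P (1 + q))"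
      using W_matrix_polynomial[of m n] by simp
  next
    fix m n q :: nat
    assume "1 \<le> m"
    then show "rho_W M X P m n q \<ge> 2 * (1 - 1 / (real n + 2)) * rho_W M X P (m - 1) (n + 1) q"
      using rho_W_mono[of n "m - 1" q] by simp
  next
    fix m n :: nat
    assume "1 \<le> m"
    then show "loewner_le ((2 * (1 - 1 / (real n + 2))) *\<^sub>R W_matrix M X P m (n + 1)) (W_matrix M X P (m + 1) n)"
      using W_matrix_mono[of n "m - 1"] by simp
  qed
qed

end
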